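(* Fix $\epsilon \in (0,1]$ with $\epsilon n$ an integer. Suppose that there are $K \ge m$ one-dimensional linear subspaces of $\mathbb{R}^m$ whose union contains all the columns $a^1,\dots,a^n$, and that $B \ge C\,\frac{m}{\epsilon^3}\log\frac{K}{\epsilon}$, where $C$ is a sufficiently large absolute constant. Then algorithm OTP returns a feasible solution of the packing LP whose expected value (over the random arrival order) is at least $(1-5\epsilon)\,\mathrm{OPT}$.
   Context: Online packing LP: positive integers $m,n$, a number $B>0$, rewards $\pi_1,\dots,\pi_n \ge 0$ and columns $a^1,\dots,a^n \in [0,1]^m\setminus\{0\}$. The (offline) LP is: maximize $\sum_{t=1}^n \pi_t x_t$ subject to $\sum_{t=1}^n a^t_i x_t \le B$ for all $i\in[m]$ and $x_t\in[0,1]$; $\mathrm{OPT}$ denotes its optimal value. The input is in general position: for every $p\in\mathbb{R}^m$ there are at most $m$ indices $t$ with $\pi_t = p\cdot a^t$. The columns $(\pi_t,a^t)$ arrive in the order $\sigma(1),\sigma(2),\dots,\sigma(n)$ for a uniformly random permutation $\sigma$ of $[n]$; $n$ is known, and each variable must be irrevocably set when its column arrives. For $p\in\mathbb{R}^m$ define $x(p)\in\{0,1\}^n$ by $x(p)_t=1$ iff $\pi_t > p\cdot a^t$. For an integer $s$ and $\delta>0$, the $(s,\delta)$-Dual is: minimize $\frac{s}{n}\delta B\sum_{i=1}^m p_i + \sum_{t=1}^s \alpha_{\sigma(t)}$ subject to $p\cdot a^{\sigma(t)} + \alpha_{\sigma(t)} \ge \pi_{\sigma(t)}$ for $t=1,\dots,s$,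 $p\ge 0$, $\alpha\ge 0$ (the dual of the LP maximizing $\sum_{t=1}^s\pi_{\sigma(t)}x_{\sigma(t)}$ subject to $\sum_{t=1}^s a^{\sigma(t)}x_{\sigma(t)}\le \frac{s}{n}\delta B$, $x\in[0,1]$). Algorithm OTP: (1) wait for the first $\epsilon n$ columns (which are assigned value $0$), and compute an optimal solution $(p,\alpha)$ of the $(\epsilon n,1-\epsilon)$-Dual; (2) for $t=\epsilon n+1,\epsilon n+2,\dots$ set $x_{\sigma(t)} = x(p)_{\sigma(t)}$ for as long as the solution obtained remains feasible for the LP; from the first time this would violate a constraint on, set all further variables to $0$. *)

theory Defs
  imports
    "HOL-Probability.Probability_Mass_Function"
    "HOL-Combinatorics.Permutations"
    "Jordan_Normal_Form.VS_Connect"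
begin

unbundle no vec_syntax and no inner_syntax

definition one_dim_subspace :: "nat \<Rightarrow> real vec set \<Rightarrow> bool" where
  "one_dim_subspace m L \<longleftrightarrow>
     VectorSpace.subspace class_ring L (module_vec TYPE(real) m) \<and>
     vectorspace.dim class_ring ((module_vec TYPE(real) m)\<lparr>carrier := L\<rparr>) = 1"

text \<open>Vectors of \<open>\<real>\<^sup>m\<close> are elements of \<^term>\<open>carrier_vec m\<close>, with coordinates \<open>0, \<dots>, m - 1\<close>;
  the columns are numbered \<open>1, \<dots>, n\<close>.  A solution is a function whose values outside
  \<open>{1..n}\<close> are irrelevant.\<close>

locale packing_lp =
  fixes m n :: nat and B :: real and \<pi> :: "nat \<Rightarrow> real" and a :: "nat \<Rightarrow> real vec"
  assumes m_pos: "0 < m" and n_pos: "0 < n" and B_pos: "0 < B"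
    and reward_nonneg: "t \<in> {1..n} \<Longrightarrow> 0 \<le> \<pi> t"
    and column_carrier: "t \<in> {1..n} \<Longrightarrow> a t \<in> carrier_vec m"
    and column_bounds: "t \<in> {1..n} \<Longrightarrow> i < m \<Longrightarrow> a t $ i \<in> {0..1}"
    and column_nonzero: "t \<in> {1..n} \<Longrightarrow> a t \<noteq> 0\<^sub>v m"
    and general_position: "p \<in> carrier_vec m \<Longrightarrow> card {t \<in> {1..n}. \<pi> t = p \<bullet> a t} \<le> m"
begin

definition feasible :: "(nat \<Rightarrow> real) \<Rightarrow> bool" where
  "feasible x \<longleftrightarrow>
     (\<forall>i<m. (\<Sum>t = 1..n. a t $ i * x t) \<le> B) \<and> (\<forall>t\<in>{1..n}. x t \<in> {0..1})"

definition val :: "(nat \<Rightarrow> real) \<Rightarrow> real" where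
  "val x = (\<Sum>t = 1..n. \<pi> t * x t)"

text \<open>The feasible region is nonempty and, on \<open>{1..n}\<close>, compact, so the supremum is attained.\<close>

definition OPT :: real where
  "OPT = (SUP x\<in>{x. feasible x}. val x)"

text \<open>\<open>pricing p\<close> is the 0/1 solution \<open>x(p)\<close>.\<close>

definition pricing :: "real vec \<Rightarrow> nat \<Rightarrow> real" where
  "pricing p t = (if \<pi> t > p \<bullet> a t then 1 else 0)"

text \<open>Feasibility, objective and optimality for the \<open>(s, \<delta>)\<close>-Dual of the arrival order \<open>\<sigma>\<close>;
  only the values of \<open>\<alpha>\<close> at \<open>\<sigma> 1, \<dots>, \<sigma> s\<close> matter.\<close>

definition dual_feasible :: "nat \<Rightarrow> (nat \<Rightarrow> nat) \<Rightarrow> real vec \<Rightarrow> (nat \<Rightarrow> real) \<Rightarrow> bool" where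
  "dual_feasible s \<sigma> p \<alpha> \<longleftrightarrow>
     p \<in> carrier_vec m \<and> (\<forall>i<m. 0 \<le> p $ i) \<and>
     (\<forall>t\<in>{1..s}. p \<bullet> a (\<sigma> t) + \<alpha> (\<sigma> t) \<ge> \<pi> (\<sigma> t) \<and> 0 \<le> \<alpha> (\<sigma> t))"

definition dual_val :: "nat \<Rightarrow> real \<Rightarrow> (nat \<Rightarrow> nat) \<Rightarrow> real vec \<Rightarrow> (nat \<Rightarrow> real) \<Rightarrow> real" where
  "dual_val s \<delta> \<sigma> p \<alpha> = real s / real n * \<delta> * B * (\<Sum>i<m. p $ i) + (\<Sum>t = 1..s. \<alpha> (\<sigma> t))"

definition dual_optimal ::
  "nat \<Rightarrow> real \<Rightarrow> (nat \<Rightarrow> nat) \<Rightarrow> real vec \<Rightarrow> (nat \<Rightarrow> real) \<Rightarrow> bool" where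
  "dual_optimal s \<delta> \<sigma> p \<alpha> \<longleftrightarrow>
     dual_feasible s \<sigma> p \<alpha> \<and>
     (\<forall>p' \<alpha>'. dual_feasible s \<sigma> p' \<alpha>' \<longrightarrow> dual_val s \<delta> \<sigma> p \<alpha> \<le> dual_val s \<delta> \<sigma> p' \<alpha>')"

definition observed :: "nat \<Rightarrow> (nat \<Rightarrow> nat) \<Rightarrow> (real \<times> real vec) list" where
  "observed s \<sigma> = map (\<lambda>t. (\<pi> (\<sigma> t), a (\<sigma> t))) [1..<Suc s]"

text \<open>A dual optimum need not be unique.  \<open>P\<close> is the rule by which the algorithm picks the \<open>p\<close>
  part of one; as the algorithm is online, \<open>P\<close> depends only on the first \<open>s\<close> arrivals.  The
  \<open>\<alpha>\<close> part is not used by the algorithm.\<close>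

definition dual_rule :: "nat \<Rightarrow> real \<Rightarrow> ((real \<times> real vec) list \<Rightarrow> real vec) \<Rightarrow> bool" where
  "dual_rule s \<delta> P \<longleftrightarrow>
     (\<forall>\<sigma>. \<sigma> permutes {1..n} \<longrightarrow> (\<exists>\<alpha>. dual_optimal s \<delta> \<sigma> (P (observed s \<sigma>)) \<alpha>))"

text \<open>\<open>run s \<sigma> p t\<close> is the state after \<open>t\<close> arrivals: the current solution, in which all
  variables not yet set are \<open>0\<close>, and a flag that turns \<^term>\<open>False\<close> at the first violation.\<close>

primrec run :: "nat \<Rightarrow> (nat \<Rightarrow> nat) \<Rightarrow> real vec \<Rightarrow> nat \<Rightarrow> (nat \<Rightarrow> real) \<times> bool" where
  "run s \<sigma> p 0 = ((\<lambda>_. 0), True)"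
| "run s \<sigma> p (Suc t) =
     (let (x, active) = run s \<sigma> p t;
          x' = x(\<sigma> (Suc t) := pricing p (\<sigma> (Suc t)))
      in if Suc t \<le> s \<or> \<not> active then (x, active)
         else if feasible x' then (x', True)
         else (x, False))"

definition OTP :: "nat \<Rightarrow> ((real \<times> real vec) list \<Rightarrow> real vec) \<Rightarrow> (nat \<Rightarrow> nat) \<Rightarrow> nat \<Rightarrow> real" where
  "OTP s P \<sigma> = fst (run s \<sigma> (P (observed s \<sigma>)) n)"

end

end

theory Submission
  imports Defs
begin

text \<open>Let \<open>S\<close> be the set of the first \<open>s = \<epsilon> n\<close> arrivals and \<open>p\<close> the computed dual optimum.
  Optimality of \<open>p\<close> and general position show that on \<open>S\<close> the solution \<open>x(p)\<close> loads every constraint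
  with at most \<open>\<epsilon> (1 - \<epsilon>) B\<close>, and with at least \<open>\<epsilon> (1 - \<epsilon>) B - m\<close> if \<open>p\<^sub>i > 0\<close>.  With probability
  at least \<open>1 - \<epsilon>\<close> this transfers to all columns: the load of \<open>x(p)\<close> is at most \<open>B\<close>, and at least
  \<open>(1 - 3 \<epsilon>) B\<close> if \<open>p\<^sub>i > 0\<close>.  Then \<open>x(p)\<close> is feasible, and by complementary slackness its value is
  at least \<open>(1 - 3 \<epsilon>) OPT\<close>.  The part of that value collected on \<open>S\<close>, which the algorithm forgoes,
  has expectation at most \<open>\<epsilon> OPT\<close>, since the average over all orders of the solutions on \<open>S\<close>, divided
  by \<open>\<epsilon>\<close>, is feasible for the full problem.

  The transfer is a union bound over Chernoff bounds for sampling without replacement, with failure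
  probability \<open>exp (- \<epsilon>\<^sup>3 B / 16)\<close> each.  To make it independent of \<open>n\<close>, the set selected by \<open>p\<close> is
  rounded on each of the \<open>K\<close> lines, where it is an initial segment, to one of \<open>O(K / \<epsilon>)\<close> segments; this
  changes no load by more than \<open>\<epsilon> B / 2\<close>.  The level sets of the rounding are half-spaces in \<open>p\<close>, so
  that no \<open>m + 1\<close> of them are shattered, and by the Sauer--Shelah lemma only \<open>(K / \<epsilon>)\<^sup>O\<^sup>(\<^sup>m\<^sup>)\<close> roundings
  occur.\<close>

section \<open>Shattering and chains\<close>

definition shatters :: "'a set set \<Rightarrow> 'a set \<Rightarrow> bool" where
  "shatters F A \<longleftrightarrow> (\<forall>B\<subseteq>A. \<exists>f\<in>F. f \<inter> A = B)"

text \<open>The Sauer--Shelah lemma in Pajor's form. Remove a point \<open>x\<close>: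
  \<open>F0\<close> is the trace of \<open>F\<close> on the rest, and \<open>F1\<close> collects the
  traces that come from two members of \<open>F\<close>. Sets shattered by \<open>F0\<close> are
  shattered by \<open>F\<close>; those shattered by \<open>F1\<close> remain so after adding
  \<open>x\<close>.\<close>

lemma card_le_card_shattered:
  assumes "finite X" "F \<subseteq> Pow X"
  shows "card F \<le> card {A. A \<subseteq> X \<and> shatters F A}"
  using assms
proof (induction X arbitrary: F rule: finite_induct)
  case empty
  then have "F = {} \<or> F = {{}}" by auto
  then show ?case
  proof
    assume F: "F = {{}}"
    then have "{A. A \<subseteq> {} \<and> shatters F A} = {{}}" by (auto simp: shatters_def)
    then show ?thesis using F by simp
  qed auto
next
  case (insert x X)
  let ?sh = "\<lambda>F X. {A. A \<subseteq> X \<and> shatters F A}"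
  define F0 where "F0 = (\<lambda>f. f - {x}) ` F"
  define F1 where "F1 = {f. x \<notin> f \<and> f \<in> F \<and> insert x f \<in> F}"
  have finF: "finite F" using insert by (meson finite.insertI finite_Pow_iff finite_subset)
  have sub: "F0 \<subseteq> Pow X" "F1 \<subseteq> Pow X" using insert.prems by (auto simp: F0_def F1_def)
  have fin1: "finite F1" using sub insert.hyps by (meson finite_Pow_iff finite_subset)
  define Fx where "Fx = {f\<in>F. x \<in> f}"
  define Fn where "Fn = {f\<in>F. x \<notin> f}"
  have "card F = card Fx + card Fn"
    using finF by (subst card_Un_disjoint [symmetric]) (auto simp: Fx_def Fn_def intro!: arg_cong[where f=card])
  moreover have "card Fx = card ((\<lambda>f. f - {x}) ` Fx)"
    by (rule card_image [symmetric]) (auto simp: inj_on_def Fx_def)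
  moreover have "F0 = (\<lambda>f. f - {x}) ` Fx \<union> Fn"
  proof -
    have "F = Fx \<union> Fn" "(\<lambda>f. f - {x}) ` Fn = id ` Fn"
      unfolding Fx_def Fn_def by (blast, intro image_cong) auto
    then show ?thesis unfolding F0_def by (metis image_Un image_id id_apply)
  qed
  moreover have "F1 = (\<lambda>f. f - {x}) ` Fx \<inter> Fn"
  proof (intro equalityI subsetI)
    fix f assume "f \<in> F1"
    then show "f \<in> (\<lambda>f. f - {x}) ` Fx \<inter> Fn"
      by (auto simp: F1_def Fx_def Fn_def intro!: image_eqI [of _ _ "insert x f"])
  qed (auto simp: F1_def Fx_def Fn_def insert_absorb)
  moreover have "finite ((\<lambda>f. f - {x}) ` Fx)" "finite Fn" using finF by (auto simp: Fx_def Fn_def)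
  \<comment> \<open>Deleting \<open>x\<close> is injective on \<open>Fx\<close>; the image and
    \<open>Fn\<close> have union \<open>F0\<close> and intersection \<open>F1\<close>.\<close>
  ultimately have "card F = card F0 + card F1"
    using card_Un_Int [of "(\<lambda>f. f - {x}) ` Fx" Fn] by simp
  also have "\<dots> \<le> card (?sh F0 X) + card (?sh F1 X)"
    using insert.IH [OF sub(1)] insert.IH [OF sub(2)] by simp
  also have "card (?sh F1 X) = card (insert x ` ?sh F1 X)"
  proof (rule card_image [symmetric])
    have "inj_on (insert x) (Pow X)" using insert.hyps by (auto intro!: inj_onI)
    then show "inj_on (insert x) (?sh F1 X)" by (rule inj_on_subset) auto
  qed
  also have "card (?sh F0 X) + card (insert x ` ?sh F1 X) = card (?sh F0 X \<union> insert x ` ?sh F1 X)"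
  proof (rule card_Un_disjoint [symmetric])
    show "finite (?sh F0 X)" "finite (insert x ` ?sh F1 X)" using insert.hyps by simp_all
    show "?sh F0 X \<inter> insert x ` ?sh F1 X = {}" using insert.hyps by blast
  qed
  also have "\<dots> \<le> card (?sh F (insert x X))"
  proof (rule card_mono)
    show "finite (?sh F (insert x X))" using insert.hyps by simp
    show "?sh F0 X \<union> insert x ` ?sh F1 X \<subseteq> ?sh F (insert x X)"
    proof
      fix A assume "A \<in> ?sh F0 X \<union> insert x ` ?sh F1 X"
      then show "A \<in> ?sh F (insert x X)"
      proof
        assume A: "A \<in> ?sh F0 X"
        then have xA: "x \<notin> A" using insert.hyps by auto
        { fix B assume "B \<subseteq> A"
          then obtain f where "f \<in> F0" "f \<inter> A = B" using A unfolding shatters_def by blast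
          then obtain g where "g \<in> F" "(g - {x}) \<inter> A = B" by (auto simp: F0_def)
          then have "\<exists>f\<in>F. f \<inter> A = B" using xA by (intro bexI[of _ g]) auto }
        then show ?thesis using A unfolding shatters_def by auto
      next
        assume "A \<in> insert x ` ?sh F1 X"
        then obtain A' where A: "A = insert x A'" "A' \<in> ?sh F1 X" by auto
        then have xA: "x \<notin> A'" using insert.hyps by auto
        { fix B assume B: "B \<subseteq> A"
          then have "B - {x} \<subseteq> A'" using A by auto
          then obtain f where f: "f \<in> F1" "f \<inter> A' = B - {x}" using A unfolding shatters_def by blast
          have "\<exists>f\<in>F. f \<inter> A = B"
          proof (cases "x \<in> B")
            case True
            then show ?thesis using f A by (intro bexI[of _ "insert x f"]) (auto simp: F1_def)
          next
            case False
            then show ?thesis using f A by (intro bexI[of _ f]) (auto simp: F1_def)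
          qed }
        then show ?thesis using A unfolding shatters_def by auto
      qed
    qed
  qed
  finally show ?case .
qed

text \<open>Such a set can be read off a list of length \<open>m\<close> over \<open>X\<close> and a
  padding symbol \<open>None\<close>.\<close>

lemma card_subsets_card_le:
  assumes "finite X"
  shows "card {A. A \<subseteq> X \<and> card A \<le> m} \<le> (card X + 1) ^ m"
proof -
  let ?O = "insert None (Some ` X)"
  let ?Ls = "{xs. set xs \<subseteq> ?O \<and> length xs = m}"
  have fin: "finite ?Ls" using assms by (intro finite_lists_length_eq) auto
  have "{A. A \<subseteq> X \<and> card A \<le> m} \<subseteq> (\<lambda>xs. {x. Some x \<in> set xs}) ` ?Ls"
  proof
    fix A assume A: "A \<in> {A. A \<subseteq> X \<and> card A \<le> m}"
    then have "finite A" using assms finite_subset by auto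
    then obtain ys where ys: "set ys = A" "distinct ys" using finite_distinct_list by auto
    define xs where "xs = map Some ys @ replicate (m - card A) None"
    have "length ys = card A" using ys distinct_card by fastforce
    then have "xs \<in> ?Ls" using A ys by (auto simp: xs_def)
    moreover have "A = {x. Some x \<in> set xs}" using ys by (auto simp: xs_def)
    ultimately show "A \<in> (\<lambda>xs. {x. Some x \<in> set xs}) ` ?Ls" by blast
  qed
  then have "card {A. A \<subseteq> X \<and> card A \<le> m} \<le> card ?Ls"
    using fin by (rule surj_card_le [rotated])
  also have "\<dots> = (card X + 1) ^ m"
    using assms by (subst card_lists_length_eq) (auto simp: card_image card_insert_if)
  finally show ?thesis .
qed

text \<open>Applied later to segments of a line: the intersection or union of all segments meeting a
  width bound is one of them, hence meets the bound.\<close>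

lemma finite_chain_Inter_Union_in:
  assumes "finite F" "F \<noteq> {}" "\<And>X Y. X \<in> F \<Longrightarrow> Y \<in> F \<Longrightarrow> X \<subseteq> Y \<or> Y \<subseteq> X"
  shows "\<Inter>F \<in> F" "\<Union>F \<in> F"
proof -
  have "\<Inter>F \<in> F \<and> \<Union>F \<in> F"
    using assms
  proof (induction rule: finite_ne_induct)
    case (insert X F)
    then have "\<Inter>F \<in> F" "\<Union>F \<in> F" by blast+
    then have "X \<subseteq> \<Inter>F \<or> \<Inter>F \<subseteq> X" "X \<subseteq> \<Union>F \<or> \<Union>F \<subseteq> X" using insert.prems by blast+
    then have "X \<inter> \<Inter>F = X \<or> X \<inter> \<Inter>F = \<Inter>F" "X \<union> \<Union>F = X \<or> X \<union> \<Union>F = \<Union>F" by blast+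
    with \<open>\<Inter>F \<in> F\<close> \<open>\<Union>F \<in> F\<close> show ?case by auto
  qed simp
  then show "\<Inter>F \<in> F" "\<Union>F \<in> F" by auto
qed

section \<open>Sampling without replacement\<close>

text \<open>Double count the pairs of a permutation whose image of \<open>J\<close> contains
  \<open>T\<close> and a point \<open>t'\<close> of that image outside \<open>T\<close>. Composing
  with a transposition shows that all \<open>t'\<close> occur equally often, and each such
  permutation admits \<open>card J - card T\<close> of them.\<close>

lemma card_perms_image_superset_insert:
  assumes A: "finite A" and J: "J \<subseteq> A" and T: "T \<subseteq> A" and t: "t \<in> A - T"
  shows "(card A - card T) * card {\<sigma>. \<sigma> permutes A \<and> insert t T \<subseteq> \<sigma> ` J}
       = (card J - card T) * card {\<sigma>. \<sigma> permutes A \<and> T \<subseteq> \<sigma> ` J}"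
proof -
  let ?G = "\<lambda>T. {\<sigma>. \<sigma> permutes A \<and> T \<subseteq> \<sigma> ` J}"
  have fin: "finite (?G T)" for T using finite_permutations [OF A] by auto
  have finT: "finite T" "finite J" using A T J finite_subset by auto
  have sym: "card (?G (insert t' T)) = card (?G (insert t T))" if t': "t' \<in> A - T" for t'
  proof -
    let ?f = "\<lambda>\<sigma>. Transposition.transpose t t' \<circ> \<sigma>"
    have p: "Transposition.transpose t t' permutes A" using t t' by (auto intro: permutes_swap_id)
    have inv: "?f (?f \<sigma>) = \<sigma>" for \<sigma> by (simp add: comp_assoc [symmetric])
    have tT: "Transposition.transpose t t' ` insert t T = insert t' T"
             "Transposition.transpose t t' ` insert t' T = insert t T"
      using t t' by (auto simp: transpose_def image_iff)
    have "bij_betw ?f (?G (insert t' T)) (?G (insert t T))"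
    proof (rule bij_betwI [where g = ?f])
      have *: "?f \<sigma> \<in> ?G S'" if "\<sigma> \<in> ?G S" "Transposition.transpose t t' ` S = S'" for \<sigma> S S'
      proof -
        have "Transposition.transpose t t' ` S \<subseteq> Transposition.transpose t t' ` \<sigma> ` J"
          using that by (intro image_mono) auto
        then show ?thesis using that permutes_compose [OF _ p] by (simp add: image_comp)
      qed
      show "?f \<in> ?G (insert t' T) \<rightarrow> ?G (insert t T)" using * [OF _ tT(2)] by blast
      show "?f \<in> ?G (insert t T) \<rightarrow> ?G (insert t' T)" using * [OF _ tT(1)] by blast
    qed (use inv in auto)
    then show ?thesis by (rule bij_betw_same_card)
  qed
  have "(card A - card T) * card (?G (insert t T)) = (\<Sum>t'\<in>A - T. card (?G (insert t' T)))"
    using sym A T finT by (simp add: card_Diff_subset)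
  also have "\<dots> = (\<Sum>t'\<in>A - T. \<Sum>\<sigma>\<in>?G T. if t' \<in> \<sigma> ` J then 1 else 0)"
  proof (intro sum.cong refl)
    fix t' assume "t' \<in> A - T"
    have "?G (insert t' T) = ?G T \<inter> {\<sigma>. t' \<in> \<sigma> ` J}" by auto
    then show "card (?G (insert t' T)) = (\<Sum>\<sigma>\<in>?G T. if t' \<in> \<sigma> ` J then 1 else 0)"
      using fin [of T] by (simp add: sum.If_cases)
  qed
  also have "\<dots> = (\<Sum>\<sigma>\<in>?G T. \<Sum>t'\<in>A - T. if t' \<in> \<sigma> ` J then 1 else 0)"
    by (rule sum.swap)
  also have "\<dots> = (\<Sum>\<sigma>\<in>?G T. card J - card T)"
  proof (intro sum.cong refl)
    fix \<sigma> assume s: "\<sigma> \<in> ?G T"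
    then have "\<sigma> ` J \<subseteq> A" using J permutes_image by blast
    then have "(A - T) \<inter> {t'. t' \<in> \<sigma> ` J} = \<sigma> ` J - T" by auto
    moreover have "card (\<sigma> ` J) = card J"
      using s permutes_inj_on [of \<sigma> A J] by (auto intro: card_image)
    ultimately show "(\<Sum>t'\<in>A - T. if t' \<in> \<sigma> ` J then 1 else 0) = card J - card T"
      using A s finT by (simp add: sum.If_cases card_Diff_subset)
  qed
  finally show ?thesis by (simp add: mult.commute)
qed

text \<open>The inclusion probability is a product of factors
  \<open>(card J - i) / (card A - i)\<close>, each at most \<open>card J / card A\<close>: sampling
  without replacement contains a given set no more often than independent sampling.\<close>

lemma card_perms_image_superset_le:
  assumes A: "finite A" and J: "J \<subseteq> A" and T: "T \<subseteq> A"
  shows "real (card {\<sigma>. \<sigma> permutes A \<and> T \<subseteq> \<sigma> ` J}) \<le> fact (card A) * (card J / card A) ^ card T"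
proof -
  have "finite T" using A T finite_subset by auto
  then show ?thesis using T
  proof (induction T rule: finite_induct)
    case empty
    show ?case using A by (simp add: card_permutations)
  next
    case (insert t T)
    let ?G = "\<lambda>T. real (card {\<sigma>. \<sigma> permutes A \<and> T \<subseteq> \<sigma> ` J})"
    have JA: "card J \<le> card A" using A J card_mono by auto
    have TA: "card T < card A"
      using A insert.hyps insert.prems by (intro psubset_card_mono) auto
    have "real (card A - card T) * ?G (insert t T) = real (card J - card T) * ?G T"
      using card_perms_image_superset_insert [OF A J, of T t] insert.hyps insert.prems
      unfolding of_nat_mult [symmetric] by simp
    then have "?G (insert t T) = real (card J - card T) / real (card A - card T) * ?G T"
      using TA by (simp add: field_simps)
    also have "\<dots> \<le> (card J / card A) * ?G T"
    proof (rule mult_right_mono)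
      show "real (card J - card T) / real (card A - card T) \<le> card J / card A"
      proof (cases "card T \<le> card J")
        case True
        have "real (card A) * real (card J - card T) \<le> real (card J) * real (card A - card T)"
          using True TA JA by (simp add: of_nat_diff algebra_simps mult_right_mono)
        then show ?thesis using TA by (simp add: field_simps)
      qed simp
    qed simp
    also have "\<dots> \<le> (card J / card A) * (fact (card A) * (card J / card A) ^ card T)"
      using insert by (intro mult_left_mono) auto
    finally show ?case using insert.hyps by (simp add: mult_ac)
  qed
qed

lemma card_perms_mem_image:
  assumes A: "finite A" and J: "J \<subseteq> A" and t: "t \<in> A"
  shows "real (card {\<sigma>. \<sigma> permutes A \<and> t \<in> \<sigma> ` J}) = fact (card A) * (card J / card A)"
proof -
  have "card A * card {\<sigma>. \<sigma> permutes A \<and> t \<in> \<sigma> ` J} = card J * fact (card A)"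
    using card_perms_image_superset_insert [OF A J, of "{}" t] t A by (simp add: card_permutations)
  from arg_cong [OF this, of real]
  have "real (card A) * real (card {\<sigma>. \<sigma> permutes A \<and> t \<in> \<sigma> ` J}) = card J * fact (card A)"
    by simp
  moreover have "card A > 0" using A t card_gt_0_iff by blast
  ultimately show ?thesis by (simp add: field_simps)
qed

text \<open>Expanding the product over the sample gives a sum over the subsets it contains. As
  \<open>z\<close> is nonnegative, the inclusion bound applies to each term, and the result factors
  as for independent sampling at rate \<open>card J / card A\<close>.\<close>

lemma sum_perms_prod_image_le:
  fixes z :: "'a \<Rightarrow> real"
  assumes A: "finite A" and J: "J \<subseteq> A" and z: "\<And>t. t \<in> A \<Longrightarrow> 0 \<le> z t"
  shows "(\<Sum>\<sigma> | \<sigma> permutes A. \<Prod>t\<in>\<sigma> ` J. 1 + z t)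
       \<le> fact (card A) * (\<Prod>t\<in>A. 1 + card J / card A * z t)"
proof -
  let ?\<rho> = "card J / card A"
  let ?P = "{\<sigma>. \<sigma> permutes A}"
  have finP: "finite ?P" using finite_permutations [OF A] .
  have expand: "(\<Prod>t\<in>S. 1 + f t) = (\<Sum>T\<in>Pow S. prod f T)" if "finite S" for f :: "'a \<Rightarrow> real" and S
    using prod_add [OF that, of "\<lambda>_. 1" f] prod_add [OF that, of f "\<lambda>_. 1"] by (simp add: add.commute)
  have "(\<Sum>\<sigma>\<in>?P. \<Prod>t\<in>\<sigma> ` J. 1 + z t) = (\<Sum>\<sigma>\<in>?P. \<Sum>T\<in>Pow A. if T \<subseteq> \<sigma> ` J then prod z T else 0)"
  proof (intro sum.cong refl)
    fix \<sigma> assume "\<sigma> \<in> ?P"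
    then have "\<sigma> ` J \<subseteq> A" using J permutes_image by blast
    then have "Pow A \<inter> {T. T \<subseteq> \<sigma> ` J} = Pow (\<sigma> ` J)" "finite (\<sigma> ` J)" using A finite_subset by auto
    then show "(\<Prod>t\<in>\<sigma> ` J. 1 + z t) = (\<Sum>T\<in>Pow A. if T \<subseteq> \<sigma> ` J then prod z T else 0)"
      using A by (simp add: expand sum.If_cases)
  qed
  also have "\<dots> = (\<Sum>T\<in>Pow A. \<Sum>\<sigma>\<in>?P. if T \<subseteq> \<sigma> ` J then prod z T else 0)"
    by (rule sum.swap)
  also have "\<dots> = (\<Sum>T\<in>Pow A. card {\<sigma>. \<sigma> permutes A \<and> T \<subseteq> \<sigma> ` J} * prod z T)"
    using finP by (simp add: sum.If_cases Collect_conj_eq)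
  also have "\<dots> \<le> (\<Sum>T\<in>Pow A. fact (card A) * ?\<rho> ^ card T * prod z T)"
    by (intro sum_mono mult_right_mono card_perms_image_superset_le A J) (auto intro!: prod_nonneg z)
  also have "\<dots> = fact (card A) * (\<Sum>T\<in>Pow A. \<Prod>t\<in>T. ?\<rho> * z t)"
    unfolding sum_distrib_left prod.distrib prod_constant mult.assoc ..
  also have "\<dots> = fact (card A) * (\<Prod>t\<in>A. 1 + ?\<rho> * z t)"
    using A by (simp add: expand)
  finally show ?thesis .
qed

section \<open>Chernoff bounds from exponential moments\<close>

lemma exp_minus_le_quadratic:
  fixes x :: real
  assumes "0 \<le> x"
  shows "exp (- x) \<le> 1 - x + x\<^sup>2"
proof -
  \<comment> \<open>The product equals \<open>1 + x ^ 3\<close>.\<close>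
  have "1 \<le> (1 - x + x\<^sup>2) * (1 + x)" using assms by (simp add: algebra_simps power2_eq_square)
  also have "\<dots> \<le> (1 - x + x\<^sup>2) * exp x"
  proof (rule mult_left_mono)
    have "1 - x + x\<^sup>2 = (1 - x / 2)\<^sup>2 + 3/4 * x\<^sup>2" by (simp add: power2_eq_square algebra_simps)
    then show "0 \<le> 1 - x + x\<^sup>2" by simp
  qed simp
  finally show ?thesis by (simp add: exp_minus field_simps)
qed

text \<open>Markov's inequality for the exponential, in counting form.\<close>

lemma card_le_exp_sum:
  fixes g :: "'a \<Rightarrow> real"
  assumes "finite P"
  shows "real (card {x\<in>P. 0 \<le> g x}) \<le> (\<Sum>x\<in>P. exp (g x))"
proof -
  have "real (card {x\<in>P. 0 \<le> g x}) = (\<Sum>x\<in>{x\<in>P. 0 \<le> g x}. 1)" by simp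
  also have "\<dots> \<le> (\<Sum>x\<in>{x\<in>P. 0 \<le> g x}. exp (g x))" by (intro sum_mono) auto
  also have "\<dots> \<le> (\<Sum>x\<in>P. exp (g x))" using assms by (intro sum_mono2) auto
  finally show ?thesis .
qed

text \<open>Upper tail at threshold \<open>h\<close>, with the parameter \<open>l\<close> left free.
  The restriction \<open>l \<le> 1\<close> makes \<open>exp x \<le> 1 + x + x\<^sup>2\<close>
  available for the exponents \<open>l * w t\<close>.\<close>

lemma card_perms_sum_ge:
  fixes w :: "'a \<Rightarrow> real"
  assumes A: "finite A" and J: "J \<subseteq> A" and w: "\<And>t. t \<in> A \<Longrightarrow> w t \<in> {0..1}"
    and l: "0 \<le> l" "l \<le> 1"
  shows "real (card {\<sigma>. \<sigma> permutes A \<and> h \<le> (\<Sum>t\<in>\<sigma> ` J. w t)})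
    \<le> fact (card A) * exp (card J / card A * (l + l\<^sup>2) * sum w A - l * h)"
proof -
  define \<rho> where "\<rho> = card J / card A"
  have \<rho>0: "0 \<le> \<rho>" by (simp add: \<rho>_def)
  let ?P = "{\<sigma>. \<sigma> permutes A}"
  have finP: "finite ?P" using finite_permutations [OF A] .
  \<comment> \<open>With this \<open>z\<close> the product of \<open>1 + z t\<close> over the sample
    is the exponential of \<open>l\<close> times its weight.\<close>
  define z where "z = (\<lambda>t. exp (l * w t) - 1)"
  have z0: "0 \<le> z t" if "t \<in> A" for t using w [OF that] l by (simp add: z_def)
  have z1: "z t \<le> (l + l\<^sup>2) * w t" if "t \<in> A" for t
  proof -
    have "0 \<le> w t" "w t \<le> 1" using w [OF that] by auto
    then have "exp (l * w t) \<le> 1 + l * w t + (l * w t)\<^sup>2"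
      using l by (intro exp_bound) (auto simp: mult_le_one)
    moreover have "(l * w t)\<^sup>2 \<le> l\<^sup>2 * w t"
      using \<open>0 \<le> w t\<close> \<open>w t \<le> 1\<close> by (simp add: power_mult_distrib power2_eq_square [of "w t"] mult_left_le mult_left_mono)
    ultimately show ?thesis by (simp add: z_def algebra_simps)
  qed
  have "{\<sigma>. \<sigma> permutes A \<and> h \<le> (\<Sum>t\<in>\<sigma> ` J. w t)} \<subseteq> {\<sigma>\<in>?P. 0 \<le> l * (\<Sum>t\<in>\<sigma> ` J. w t) - l * h}"
    using l by (auto intro: mult_left_mono)
  then have "real (card {\<sigma>. \<sigma> permutes A \<and> h \<le> (\<Sum>t\<in>\<sigma> ` J. w t)})
     \<le> card {\<sigma>\<in>?P. 0 \<le> l * (\<Sum>t\<in>\<sigma> ` J. w t) - l * h}"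
    using finP by (intro of_nat_mono card_mono) auto
  also have "\<dots> \<le> (\<Sum>\<sigma>\<in>?P. exp (l * (\<Sum>t\<in>\<sigma> ` J. w t) - l * h))"
    using finP by (rule card_le_exp_sum)
  also have "\<dots> = (\<Sum>\<sigma>\<in>?P. \<Prod>t\<in>\<sigma> ` J. 1 + z t) * exp (- l * h)"
    unfolding sum_distrib_right
  proof (intro sum.cong refl)
    fix \<sigma> assume "\<sigma> \<in> ?P"
    then have "\<sigma> ` J \<subseteq> A" using J permutes_image by blast
    then have "finite (\<sigma> ` J)" using A finite_subset by auto
    then show "exp (l * (\<Sum>t\<in>\<sigma> ` J. w t) - l * h) = (\<Prod>t\<in>\<sigma> ` J. 1 + z t) * exp (- l * h)"
      by (simp add: z_def exp_sum [symmetric] sum_distrib_left exp_add [symmetric])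
  qed
  also have "\<dots> \<le> (fact (card A) * (\<Prod>t\<in>A. 1 + \<rho> * z t)) * exp (- l * h)"
    unfolding \<rho>_def by (intro mult_right_mono sum_perms_prod_image_le A J z0) auto
  also have "\<dots> \<le> (fact (card A) * (\<Prod>t\<in>A. exp (\<rho> * ((l + l\<^sup>2) * w t)))) * exp (- l * h)"
  proof (intro mult_right_mono mult_left_mono prod_mono)
    fix t assume t: "t \<in> A"
    have "1 + \<rho> * z t \<le> exp (\<rho> * z t)" by (rule exp_ge_add_one_self)
    also have "\<dots> \<le> exp (\<rho> * ((l + l\<^sup>2) * w t))" using z1 [OF t] \<rho>0 by (simp add: mult_left_mono)
    finally show "0 \<le> 1 + \<rho> * z t \<and> 1 + \<rho> * z t \<le> exp (\<rho> * ((l + l\<^sup>2) * w t))"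
      using z0 [OF t] \<rho>0 by simp
  qed auto
  also have "\<dots> = fact (card A) * exp (\<rho> * (l + l\<^sup>2) * sum w A - l * h)"
    using A by (simp add: exp_sum [symmetric] sum_distrib_left [symmetric] mult.assoc exp_add [symmetric])
  finally show ?thesis unfolding \<rho>_def .
qed

text \<open>Lower tail. A negative exponent would make \<open>z\<close> negative, which
  \<open>sum_perms_prod_image_le\<close> excludes. The weight of the sample is therefore written as
  the total minus the weight of the complement, for which the exponent is positive.\<close>

lemma card_perms_sum_le:
  fixes w :: "'a \<Rightarrow> real"
  assumes A: "finite A" and J: "J \<subseteq> A" and w: "\<And>t. t \<in> A \<Longrightarrow> w t \<in> {0..1}"
    and l: "0 \<le> l" and ne: "A \<noteq> {}"
  shows "real (card {\<sigma>. \<sigma> permutes A \<and> (\<Sum>t\<in>\<sigma> ` J. w t) \<le> h})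
    \<le> fact (card A) * exp (l * h - card J / card A * (l - l\<^sup>2) * sum w A)"
proof -
  define \<rho> where "\<rho> = card J / card A"
  have \<rho>0: "0 \<le> \<rho>" by (simp add: \<rho>_def)
  let ?P = "{\<sigma>. \<sigma> permutes A}"
  have finP: "finite ?P" using finite_permutations [OF A] .
  have cA: "card A > 0" using A ne card_gt_0_iff by blast
  have JA: "card J \<le> card A" using A J card_mono by auto
  have cmpl: "card (A - J) / card A = 1 - \<rho>"
    using finite_subset [OF J A] J JA cA ne A
    by (simp add: \<rho>_def card_Diff_subset of_nat_diff diff_divide_distrib)
  define z where "z = (\<lambda>t. exp (l * w t) - 1)"
  have z0: "0 \<le> z t" if "t \<in> A" for t using w [OF that] l by (simp add: z_def)
  \<comment> \<open>Multiplying the factor at the complementary rate \<open>1 - \<rho>\<close> by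
    the share of the total weight turns it into the factor for a negative exponent at rate
    \<open>\<rho>\<close>.\<close>
  have z1: "exp (- (l * w t)) * (1 + (1 - \<rho>) * z t) \<le> exp (- \<rho> * ((l - l\<^sup>2) * w t))" if "t \<in> A" for t
  proof -
    have w01: "0 \<le> w t" "w t \<le> 1" using w [OF that] by auto
    have "exp (- (l * w t)) * (1 + (1 - \<rho>) * z t) = 1 + \<rho> * (exp (- (l * w t)) - 1)"
      by (simp add: z_def algebra_simps exp_minus)
    also have "\<dots> \<le> exp (\<rho> * (exp (- (l * w t)) - 1))" by (rule exp_ge_add_one_self)
    also have "\<dots> \<le> exp (\<rho> * (- ((l - l\<^sup>2) * w t)))"
    proof -
      have "exp (- (l * w t)) \<le> 1 - l * w t + (l * w t)\<^sup>2"
        using l w01 by (intro exp_minus_le_quadratic) auto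
      moreover have "(l * w t)\<^sup>2 \<le> l\<^sup>2 * w t"
        using w01 by (simp add: power_mult_distrib power2_eq_square [of "w t"] mult_left_le mult_left_mono)
      ultimately have "exp (- (l * w t)) - 1 \<le> - ((l - l\<^sup>2) * w t)" by (simp add: algebra_simps)
      from mult_left_mono [OF this \<rho>0] show ?thesis by simp
    qed
    finally show ?thesis by simp
  qed
  have "{\<sigma>. \<sigma> permutes A \<and> (\<Sum>t\<in>\<sigma> ` J. w t) \<le> h} \<subseteq> {\<sigma>\<in>?P. 0 \<le> l * h - l * (\<Sum>t\<in>\<sigma> ` J. w t)}"
    using l by (auto intro: mult_left_mono)
  then have "real (card {\<sigma>. \<sigma> permutes A \<and> (\<Sum>t\<in>\<sigma> ` J. w t) \<le> h})
     \<le> card {\<sigma>\<in>?P. 0 \<le> l * h - l * (\<Sum>t\<in>\<sigma> ` J. w t)}"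
    using finP by (intro of_nat_mono card_mono) auto
  also have "\<dots> \<le> (\<Sum>\<sigma>\<in>?P. exp (l * h - l * (\<Sum>t\<in>\<sigma> ` J. w t)))"
    using finP by (rule card_le_exp_sum)
  also have "\<dots> = (\<Sum>\<sigma>\<in>?P. \<Prod>t\<in>\<sigma> ` (A - J). 1 + z t) * exp (l * h - l * sum w A)"
    unfolding sum_distrib_right
  proof (intro sum.cong refl)
    fix \<sigma> assume s: "\<sigma> \<in> ?P"
    then have "\<sigma> ` J \<subseteq> A" using J permutes_image by blast
    moreover have "\<sigma> ` (A - J) = A - \<sigma> ` J"
      using s by (simp add: image_set_diff permutes_inj permutes_image)
    ultimately have "finite (\<sigma> ` (A - J))" "(\<Sum>t\<in>\<sigma> ` J. w t) = sum w A - (\<Sum>t\<in>\<sigma> ` (A - J). w t)"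
      using A by (auto simp: sum_diff)
    then show "exp (l * h - l * (\<Sum>t\<in>\<sigma> ` J. w t)) = (\<Prod>t\<in>\<sigma> ` (A - J). 1 + z t) * exp (l * h - l * sum w A)"
      by (simp add: z_def exp_sum [symmetric] sum_distrib_left [symmetric] exp_add [symmetric] right_diff_distrib)
  qed
  also have "\<dots> \<le> (fact (card A) * (\<Prod>t\<in>A. 1 + card (A - J) / card A * z t)) * exp (l * h - l * sum w A)"
    by (intro mult_right_mono sum_perms_prod_image_le A z0) auto
  also have "\<dots> = fact (card A) * (\<Prod>t\<in>A. exp (- (l * w t)) * (1 + (1 - \<rho>) * z t)) * exp (l * h)"
  proof -
    have "(\<Prod>t\<in>A. exp (- (l * w t))) * exp (l * h) = exp (l * h - l * sum w A)"
      using A by (simp add: exp_sum [symmetric] sum_negf sum_distrib_left [symmetric] exp_add [symmetric])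
    then show ?thesis by (simp add: cmpl prod.distrib)
  qed
  also have "\<dots> \<le> fact (card A) * (\<Prod>t\<in>A. exp (- \<rho> * ((l - l\<^sup>2) * w t))) * exp (l * h)"
  proof (intro mult_right_mono mult_left_mono prod_mono)
    fix t assume t: "t \<in> A"
    have "\<rho> \<le> 1" using JA cA by (simp add: \<rho>_def)
    then show "0 \<le> exp (- (l * w t)) * (1 + (1 - \<rho>) * z t)
        \<and> exp (- (l * w t)) * (1 + (1 - \<rho>) * z t) \<le> exp (- \<rho> * ((l - l\<^sup>2) * w t))"
      using z0 [OF t] z1 [OF t] by simp
  qed auto
  also have "\<dots> = fact (card A) * exp (l * h - \<rho> * (l - l\<^sup>2) * sum w A)"
    using A by (simp add: exp_sum [symmetric] sum_negf sum_distrib_left [symmetric] mult.assoc exp_add [symmetric])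
  finally show ?thesis unfolding \<rho>_def .
qed

section \<open>Linear algebra\<close>

lemma one_dim_subspace_generator:
  assumes "one_dim_subspace m L"
  obtains v where "v \<in> carrier_vec m" "\<And>x. x \<in> L \<Longrightarrow> \<exists>k. x = k \<cdot>\<^sub>v v"
proof -
  interpret vec_space "TYPE(real)" m .
  have sub: "VectorSpace.subspace class_ring L V" and dim: "vectorspace.dim class_ring (vs L) = 1"
    using assms by (auto simp: one_dim_subspace_def)
  interpret W: vectorspace class_ring "vs L" using subspace_is_vs [OF sub] .
  have smod: "submodule class_ring L V" using sub by (simp add: VectorSpace.subspace_def)
  then have LV: "L \<subseteq> carrier_vec m" by (auto simp: submodule_def)
  \<comment> \<open>A finite basis is obtained as a maximal independent set: independence inside
    \<open>L\<close> implies independence in the whole space, so the sizes are bounded.\<close>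
  have "\<exists>A. finite A \<and> maximal A (\<lambda>S. S \<subseteq> carrier (vs L) \<and> W.lin_indpt S)"
  proof (rule maximal_exists)
    show "{} \<subseteq> carrier (vs L) \<and> W.lin_indpt {}" by (simp add: W.lin_dep_def)
    fix A assume "A \<subseteq> carrier (vs L) \<and> W.lin_indpt A"
    then have "A \<subseteq> carrier V" "lin_indpt A"
      using LV span_li_not_depend(2) [OF _ smod, of A] by auto
    then show "finite A \<and> card A \<le> dim" using li_le_dim by auto
  qed
  then obtain A where A: "finite A" "W.basis A" using W.max_li_is_basis by blast
  then have "card A = 1" using W.dim_basis [of A] dim by simp
  then obtain v where v: "A = {v}" by (auto simp: card_1_singleton_iff)
  then have vL: "v \<in> L" and gen: "W.span {v} = L" using A by (auto simp: W.basis_def)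
  then have sp: "span {v} = L" using span_li_not_depend(1) [OF _ smod, of "{v}"] by auto
  have vV: "v \<in> carrier_vec m" using vL LV by auto
  show thesis
  proof (rule that [OF vV])
    fix x assume "x \<in> L"
    then obtain k where k: "x = lincomb k {v}"
      using sp finite_span [of "{v}"] vV by auto
    have "x = k v \<cdot>\<^sub>v v"
    proof (rule eq_vecI)
      show "x $ i = (k v \<cdot>\<^sub>v v) $ i" if "i < dim_vec (k v \<cdot>\<^sub>v v)" for i
        using that vV k lincomb_index [of i "{v}" k] by auto
    qed (use k vV lincomb_dim [of "{v}" k] in auto)
    then show "\<exists>k. x = k \<cdot>\<^sub>v v" ..
  qed
qed

text \<open>Stated for an indexed family because the same direction will occur at several heights
  \<open>k\<close>. The vectors are the columns of a square matrix padded with zero rows, which is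
  singular.\<close>

lemma vec_linear_dependence:
  fixes u :: "'b \<Rightarrow> real vec"
  assumes "finite I" "m < card I" "\<And>x. x \<in> I \<Longrightarrow> u x \<in> carrier_vec m"
  obtains c where "\<exists>x\<in>I. c x \<noteq> 0" "\<And>i. i < m \<Longrightarrow> (\<Sum>x\<in>I. c x * u x $ i) = 0"
proof -
  let ?N = "card I"
  obtain e where e: "bij_betw e {..<?N} I" using assms(1) ex_bij_betw_nat_finite atLeast0LessThan by metis
  define M where "M = mat ?N ?N (\<lambda>(i, j). if i < m then u (e j) $ i else 0)"
  have M: "M \<in> carrier_mat ?N ?N" by (simp add: M_def)
  \<comment> \<open>Row \<open>m\<close> exists because \<open>m < card I\<close>, and it is a
    padding row.\<close>
  have "M = mat\<^sub>r ?N ?N (\<lambda>i. if i = m then 0\<^sub>v ?N else row M i)"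
    by (rule eq_matI) (auto simp: M_def)
  then have "det M = det (mat\<^sub>r ?N ?N (\<lambda>i. if i = m then 0\<^sub>v ?N else row M i))"
    by (rule arg_cong)
  also have "\<dots> = 0" using M by (intro det_row_0 [OF assms(2)]) auto
  finally have "det M = 0" .
  then obtain y where y: "y \<in> carrier_vec ?N" "y \<noteq> 0\<^sub>v ?N" "M *\<^sub>v y = 0\<^sub>v ?N"
    using det_0_iff_vec_prod_zero_field [OF M] by auto
  define g where "g = inv_into {..<?N} e"
  have g: "g (e j) = j" if "j < ?N" for j using e that by (auto simp: g_def bij_betw_def inv_into_f_f)
  show thesis
  proof (rule that [of "\<lambda>x. y $ g x"])
    obtain j where "j < ?N" "y $ j \<noteq> 0" using y by (metis carrier_vecD eq_vecI index_zero_vec)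
    then show "\<exists>x\<in>I. y $ g x \<noteq> 0" using e g by (intro bexI [of _ "e j"]) (auto simp: bij_betw_def)
    fix i assume i: "i < m"
    have "(\<Sum>x\<in>I. y $ g x * u x $ i) = (\<Sum>j<?N. y $ j * u (e j) $ i)"
      using g by (subst sum.reindex_bij_betw [OF e, symmetric]) auto
    also have "\<dots> = (M *\<^sub>v y) $ i"
      using i y(1) assms(2) by (simp add: M_def scalar_prod_def atLeast0LessThan mult.commute)
    finally show "(\<Sum>x\<in>I. y $ g x * u x $ i) = 0" using y i assms(2) by simp
  qed
qed

section \<open>Optimality conditions of the sample dual\<close>

text \<open>Supplies perturbation steps below finitely many positive gaps; the inserted 1 covers an
  empty \<open>F\<close>.\<close>

lemma ex_pos_lower_bound:
  fixes F :: "real set"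
  assumes "finite F" "\<And>x. x \<in> F \<Longrightarrow> 0 < x"
  obtains h where "0 < h" "\<And>x. x \<in> F \<Longrightarrow> h \<le> x"
proof (rule that [of "Min (insert 1 F)"])
  show "0 < Min (insert 1 F)" using assms by auto
  show "Min (insert 1 F) \<le> x" if "x \<in> F" for x using assms that by (intro Min_le) auto
qed

context packing_lp
begin

definition sel :: "real vec \<Rightarrow> nat set" where
  "sel p = {t \<in> {1..n}. p \<bullet> a t < \<pi> t}"

definition load :: "nat \<Rightarrow> nat set \<Rightarrow> real" where
  "load i Y = (\<Sum>t\<in>Y. a t $ i)"

lemma scalar_prod_column:
  assumes "t \<in> {1..n}"
  shows "p \<bullet> a t = (\<Sum>i<m. p $ i * a t $ i)"
  using column_carrier [OF assms] by (simp add: scalar_prod_def atLeast0LessThan)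

lemma column_01: "t \<in> {1..n} \<Longrightarrow> i < m \<Longrightarrow> 0 \<le> a t $ i \<and> a t $ i \<le> 1"
  using column_bounds by auto

lemma finite_sel [simp]: "finite (sel p)"
  and sel_subset: "sel p \<subseteq> {1..n}"
  by (auto simp: sel_def)

lemma load_mono:
  assumes "i < m" "X \<subseteq> Y" "Y \<subseteq> {1..n}"
  shows "load i X \<le> load i Y"
  unfolding load_def using assms column_01 by (intro sum_mono2) (auto intro: finite_subset)

lemma pricing_eq: "t \<in> {1..n} \<Longrightarrow> pricing p t = (if t \<in> sel p then 1 else 0)"
  by (auto simp: pricing_def sel_def)

lemma load_pricing:
  assumes "Y \<subseteq> {1..n}"
  shows "(\<Sum>t\<in>Y. a t $ i * pricing p t) = load i (sel p \<inter> Y)"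
proof -
  have "(\<Sum>t\<in>Y. a t $ i * pricing p t) = (\<Sum>t\<in>Y. if t \<in> sel p then a t $ i else 0)"
    using assms pricing_eq by (intro sum.cong) auto
  also have "\<dots> = load i (sel p \<inter> Y)"
    using finite_subset [OF assms] by (simp add: load_def sum.inter_restrict [symmetric] Int_commute)
  finally show ?thesis .
qed

lemma sample_props:
  assumes "\<sigma> permutes {1..n}" "s \<le> n"
  shows "\<sigma> ` {1..s} \<subseteq> {1..n}" "inj_on \<sigma> {1..s}"
  using assms permutes_in_image [of \<sigma> "{1..n}"] permutes_inj_on [OF assms(1)] by auto

text \<open>The least \<open>\<alpha>\<close> that is dual feasible together with \<open>p\<close>;
  it eliminates \<open>\<alpha>\<close> from the dual.\<close>

definition surplus :: "real vec \<Rightarrow> nat \<Rightarrow> real" where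
  "surplus p t = max 0 (\<pi> t - p \<bullet> a t)"

text \<open>An optimal \<open>\<alpha>\<close> dominates \<open>surplus p\<close>, so
  \<open>p\<close> alone minimizes a piecewise linear convex function over the nonnegative
  vectors.\<close>

lemma dual_optimal_surplus:
  assumes \<sigma>: "\<sigma> permutes {1..n}" and s: "s \<le> n"
    and opt: "dual_optimal s \<delta> \<sigma> p \<alpha>"
    and q: "q \<in> carrier_vec m" "\<And>i. i < m \<Longrightarrow> 0 \<le> q $ i"
  shows "real s / real n * \<delta> * B * (\<Sum>i<m. p $ i) + (\<Sum>t\<in>\<sigma> ` {1..s}. surplus p t)
       \<le> real s / real n * \<delta> * B * (\<Sum>i<m. q $ i) + (\<Sum>t\<in>\<sigma> ` {1..s}. surplus q t)"
proof -
  have inj: "inj_on \<sigma> {1..s}" using sample_props [OF \<sigma> s] by auto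
  have "dual_feasible s \<sigma> q (surplus q)" using q by (auto simp: dual_feasible_def surplus_def)
  then have "dual_val s \<delta> \<sigma> p \<alpha> \<le> dual_val s \<delta> \<sigma> q (surplus q)"
    using opt by (simp add: dual_optimal_def)
  moreover have "(\<Sum>t\<in>\<sigma> ` {1..s}. surplus p t) \<le> (\<Sum>t = 1..s. \<alpha> (\<sigma> t))"
    using opt unfolding sum.reindex [OF inj] o_def
    by (intro sum_mono) (auto simp: dual_optimal_def dual_feasible_def surplus_def algebra_simps)
  ultimately show ?thesis unfolding dual_val_def sum.reindex [OF inj] o_def by linarith
qed

lemma dual_optimal_carrier:
  assumes "dual_optimal s \<delta> \<sigma> p \<alpha>"
  shows "p \<in> carrier_vec m" "\<And>i. i < m \<Longrightarrow> 0 \<le> p $ i"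
  using assms by (auto simp: dual_optimal_def dual_feasible_def)

lemma shift_coordinate:
  assumes "i < m" "t \<in> {1..n}"
  shows "vec m (\<lambda>j. p $ j + (if j = i then h else 0)) \<bullet> a t = p \<bullet> a t + h * a t $ i"
  using assms by (simp add: scalar_prod_column distrib_right sum.distrib if_distrib [of "\<lambda>x. x * _"] cong: if_cong)

text \<open>The two bounds are the one-sided optimality conditions of the dual in direction \<open>i\<close>.
  Columns with \<open>\<pi> t = p \<bullet> a t\<close> contribute to the left derivative only, and by general position
  there are at most \<open>m\<close> of them.\<close>

lemma dual_optimal_load:
  assumes \<sigma>: "\<sigma> permutes {1..n}" and s: "s \<le> n"
    and opt: "dual_optimal s \<delta> \<sigma> p \<alpha>" and i: "i < m"
  shows "load i (sel p \<inter> \<sigma> ` {1..s}) \<le> real s / real n * \<delta> * B"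
    and "0 < p $ i \<Longrightarrow> real s / real n * \<delta> * B - real m \<le> load i (sel p \<inter> \<sigma> ` {1..s})"
proof -
  let ?S = "\<sigma> ` {1..s}"
  define c where "c = real s / real n * \<delta> * B"
  define q where "q = (\<lambda>h. vec m (\<lambda>j. p $ j + (if j = i then h else 0)))"
  have S: "?S \<subseteq> {1..n}" "finite ?S" using sample_props [OF \<sigma> s] by auto
  have p: "p \<in> carrier_vec m" "\<And>i. i < m \<Longrightarrow> 0 \<le> p $ i" using dual_optimal_carrier [OF opt] by auto
  have q: "0 \<le> c * h + (\<Sum>t\<in>?S. surplus (q h) t - surplus p t)" if "0 \<le> p $ i + h" for h
  proof -
    have "0 \<le> q h $ j" if "j < m" for j using that p(2) [OF that] \<open>0 \<le> p $ i + h\<close> by (auto simp: q_def)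
    then have "c * (\<Sum>i<m. p $ i) + (\<Sum>t\<in>?S. surplus p t) \<le> c * (\<Sum>i<m. q h $ i) + (\<Sum>t\<in>?S. surplus (q h) t)"
      unfolding c_def by (intro dual_optimal_surplus [OF \<sigma> s opt]) (auto simp: q_def)
    moreover have "(\<Sum>i<m. q h $ i) = (\<Sum>j<m. p $ j) + h"
      using i by (simp add: q_def sum.distrib)
    ultimately show ?thesis by (simp add: sum_subtractf distrib_left)
  qed
  have qa: "q h \<bullet> a t = p \<bullet> a t + h * a t $ i" if "t \<in> {1..n}" for h t
    unfolding q_def using shift_coordinate [OF i that] .
  show "load i (sel p \<inter> ?S) \<le> c"
  proof -
    \<comment> \<open>The step \<open>h\<close> is below the surplus of every selected column, so
      raising the price by \<open>h\<close> reduces each surplus linearly; all other surpluses stay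
      0.\<close>
    obtain h where h: "0 < h" "\<And>x. x \<in> (\<lambda>t. \<pi> t - p \<bullet> a t) ` sel p \<Longrightarrow> h \<le> x"
      by (rule ex_pos_lower_bound [of "(\<lambda>t. \<pi> t - p \<bullet> a t) ` sel p"]) (auto simp: sel_def)
    have "surplus (q h) t - surplus p t = (if t \<in> sel p then - h * a t $ i else 0)" if "t \<in> ?S" for t
    proof -
      have t: "t \<in> {1..n}" using that S by auto
      have ha: "0 \<le> h * a t $ i" "h * a t $ i \<le> h" using column_01 [OF t i] h(1) by (auto simp: mult_left_le)
      show ?thesis
        using ha qa [OF t, of h] h(2) [of "\<pi> t - p \<bullet> a t"] t
        by (cases "t \<in> sel p") (auto simp: surplus_def sel_def)
    qed
    then have "(\<Sum>t\<in>?S. surplus (q h) t - surplus p t) = (\<Sum>t\<in>?S. if t \<in> sel p then - h * a t $ i else 0)"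
      by (intro sum.cong) auto
    also have "\<dots> = - h * load i (sel p \<inter> ?S)"
      using S by (simp add: load_def sum.inter_restrict [symmetric] Int_commute sum_distrib_left sum_negf)
    finally have "h * load i (sel p \<inter> ?S) \<le> h * c" using q [of h] p(2) [OF i] h(1) by (simp add: mult.commute)
    then show ?thesis using h(1) by simp
  qed
  show "c - real m \<le> load i (sel p \<inter> ?S)" if pi: "0 < p $ i"
  proof -
    let ?W = "{t \<in> {1..n}. \<pi> t < p \<bullet> a t}" and ?T = "{t \<in> {1..n}. \<pi> t = p \<bullet> a t}"
    \<comment> \<open>Here \<open>h \<le> p $ i\<close> keeps the lowered price nonnegative, and
      strictly rejected columns stay without surplus. Only a tied column can newly gain, by at most
      \<open>h\<close>.\<close>
    obtain h where h: "0 < h" "\<And>x. x \<in> insert (p $ i) ((\<lambda>t. p \<bullet> a t - \<pi> t) ` ?W) \<Longrightarrow> h \<le> x"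
      by (rule ex_pos_lower_bound [of "insert (p $ i) ((\<lambda>t. p \<bullet> a t - \<pi> t) ` ?W)"]) (use pi in auto)
    have "surplus (q (- h)) t - surplus p t \<le> (if t \<in> sel p then h * a t $ i else 0) + (if t \<in> ?T then h else 0)"
      if "t \<in> ?S" for t
    proof -
      have t: "t \<in> {1..n}" using that S by auto
      have ha: "0 \<le> h * a t $ i" "h * a t $ i \<le> h" using column_01 [OF t i] h(1) by (auto simp: mult_left_le)
      show ?thesis
        using ha qa [OF t, of "- h"] h(2) [of "p \<bullet> a t - \<pi> t"] t
        by (cases "t \<in> sel p"; cases "t \<in> ?W") (auto simp: surplus_def sel_def)
    qed
    then have "(\<Sum>t\<in>?S. surplus (q (- h)) t - surplus p t)
        \<le> (\<Sum>t\<in>?S. (if t \<in> sel p then h * a t $ i else 0) + (if t \<in> ?T then h else 0))"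
      by (intro sum_mono) auto
    also have "\<dots> = h * load i (sel p \<inter> ?S) + h * real (card (?S \<inter> ?T))"
      using S by (simp add: sum.distrib load_def sum.inter_restrict [symmetric] Int_commute sum_distrib_left sum.If_cases)
    also have "\<dots> \<le> h * load i (sel p \<inter> ?S) + h * real m"
    proof -
      have "card (?S \<inter> ?T) \<le> card ?T" by (intro card_mono) auto
      also have "\<dots> \<le> m" using general_position [OF p(1)] .
      finally show ?thesis using h(1) by simp
    qed
    finally have "h * c \<le> h * (load i (sel p \<inter> ?S) + real m)"
      using q [of "- h"] h(2) [of "p $ i"] by (simp add: algebra_simps)
    then show ?thesis using h(1) by simp
  qed
qed

section \<open>Rounding along the lines\<close>

definition width :: "nat \<Rightarrow> real" where
  "width t = Max ((\<lambda>i. a t $ i) ` {..<m})"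

text \<open>Normalized to largest entry 1, so that columns on the same line through the origin get
  the same direction.\<close>

definition dir :: "nat \<Rightarrow> real vec" where
  "dir t = vec m (\<lambda>i. a t $ i / width t)"

definition dirs :: "real vec set" where
  "dirs = dir ` {1..n}"

text \<open>A column \<open>t\<close> of direction \<open>d\<close> is selected iff
  \<open>width t * price p d < \<pi> t\<close>: on a line, selection depends on \<open>p\<close>
  only through this number.\<close>

definition price :: "real vec \<Rightarrow> real vec \<Rightarrow> real" where
  "price p d = (\<Sum>i<m. p $ i * d $ i)"

definition line :: "real vec \<Rightarrow> real vec \<Rightarrow> nat set" where
  "line d p = {t \<in> sel p. dir t = d}"

lemma column_le_width: "i < m \<Longrightarrow> a t $ i \<le> width t"
  unfolding width_def by (intro Max_ge) auto

lemma width_attained: obtains i where "i < m" "a t $ i = width t"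
proof -
  have "width t \<in> (\<lambda>i. a t $ i) ` {..<m}" unfolding width_def using m_pos by (intro Max_in) auto
  then show thesis using that by auto
qed

lemma width_pos: assumes t: "t \<in> {1..n}" shows "0 < width t"
proof -
  have "\<exists>i<m. a t $ i \<noteq> 0"
  proof (rule ccontr)
    assume "\<not> ?thesis"
    then have "a t = 0\<^sub>v m" using column_carrier [OF t] by (intro eq_vecI) auto
    then show False using column_nonzero [OF t] by simp
  qed
  then obtain i where "i < m" "a t $ i \<noteq> 0" by auto
  then show ?thesis using column_01 [OF t, of i] column_le_width [of i t] by linarith
qed

lemma column_eq: "t \<in> {1..n} \<Longrightarrow> i < m \<Longrightarrow> a t $ i = width t * dir t $ i"
  using width_pos [of t] by (simp add: dir_def)

lemma dir_01: "t \<in> {1..n} \<Longrightarrow> i < m \<Longrightarrow> 0 \<le> dir t $ i \<and> dir t $ i \<le> 1"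
  using width_pos [of t] column_01 [of t i] column_le_width [of i t] by (simp add: dir_def)

lemma dirs_facts:
  shows "finite dirs" and "d \<in> dirs \<Longrightarrow> d \<in> carrier_vec m"
    and "d \<in> dirs \<Longrightarrow> i < m \<Longrightarrow> 0 \<le> d $ i \<and> d $ i \<le> 1"
    and "d \<in> dirs \<Longrightarrow> \<exists>i<m. d $ i = 1"
proof -
  show "d \<in> dirs \<Longrightarrow> \<exists>i<m. d $ i = 1"
  proof -
    assume "d \<in> dirs"
    then obtain t where t: "t \<in> {1..n}" "d = dir t" by (auto simp: dirs_def)
    obtain i where "i < m" "a t $ i = width t" by (rule width_attained)
    then show ?thesis using width_pos [OF t(1)] t(2) by (auto simp: dir_def intro!: exI [of _ i])
  qed
qed (use dir_01 in \<open>auto simp: dirs_def dir_def\<close>)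

text \<open>Both columns are multiples of one generator. Nonnegative entries force their ratio
  \<open>r\<close> to be positive, so the widths have the same ratio and it cancels.\<close>

lemma dir_eq_of_same_line:
  assumes "one_dim_subspace m L" and t: "t \<in> {1..n}" "a t \<in> L" and u: "u \<in> {1..n}" "a u \<in> L"
  shows "dir t = dir u"
proof -
  obtain v where v: "v \<in> carrier_vec m" "\<And>x. x \<in> L \<Longrightarrow> \<exists>k. x = k \<cdot>\<^sub>v v"
    using one_dim_subspace_generator [OF assms(1)] by blast
  obtain k l where kl: "a t = k \<cdot>\<^sub>v v" "a u = l \<cdot>\<^sub>v v" using v t u by metis
  have "l \<noteq> 0" using column_nonzero [OF u(1)] kl(2) v(1) by auto
  define r where "r = k / l"
  have r: "a t $ i = r * a u $ i" if "i < m" for i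
    using that kl v(1) \<open>l \<noteq> 0\<close> by (simp add: r_def)
  obtain i where i: "i < m" "a t $ i = width t" by (rule width_attained)
  obtain j where j: "j < m" "a u $ j = width u" by (rule width_attained)
  have "0 < width t" "0 < width u" using width_pos t u by auto
  have "0 < r * a u $ i" using r i \<open>0 < width t\<close> by simp
  then have "0 < r" using column_01 [OF u(1) i(1)] by (simp add: zero_less_mult_iff)
  have "width t \<le> r * width u" using r i column_le_width [of i u] \<open>0 < r\<close> by (simp flip: i(2))
  moreover have "r * width u \<le> width t" using r [OF j(1)] j column_le_width [of j t] by simp
  ultimately have "width t = r * width u" by simp
  then show ?thesis using r \<open>0 < r\<close> unfolding dir_def by (intro eq_vecI) auto
qed

text \<open>Each line carries at most one direction, that of any column on it.\<close>

lemma card_dirs_le: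
  assumes "finite \<L>" "\<And>L. L \<in> \<L> \<Longrightarrow> one_dim_subspace m L" "a ` {1..n} \<subseteq> \<Union>\<L>"
  shows "card dirs \<le> card \<L>"
proof -
  define g where "g = (\<lambda>L. dir (SOME t. t \<in> {1..n} \<and> a t \<in> L))"
  have "dirs \<subseteq> g ` \<L>"
  proof
    fix d assume "d \<in> dirs"
    then obtain t where t: "t \<in> {1..n}" "d = dir t" by (auto simp: dirs_def)
    then obtain L where L: "L \<in> \<L>" "a t \<in> L" using assms(3) by (meson UnionE imageI subsetD)
    let ?u = "SOME t. t \<in> {1..n} \<and> a t \<in> L"
    have "?u \<in> {1..n} \<and> a ?u \<in> L" by (rule someI [of _ t]) (use t L in auto)
    then have "d = g L" using dir_eq_of_same_line [OF assms(2) [OF L(1)] t(1) L(2)] t(2) by (simp add: g_def)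
    then show "d \<in> g ` \<L>" using L by blast
  qed
  then show ?thesis using assms(1) by (rule surj_card_le [rotated])
qed

section \<open>Selected segments on a line\<close>

lemma price_column: "t \<in> {1..n} \<Longrightarrow> p \<bullet> a t = width t * price p (dir t)"
  by (simp add: scalar_prod_column price_def sum_distrib_left column_eq mult_ac)

lemma line_antimono: assumes "price p d \<le> price q d" shows "line d q \<subseteq> line d p"
proof
  fix t assume t: "t \<in> line d q"
  then have "t \<in> {1..n}" "d = dir t" "q \<bullet> a t < \<pi> t" by (auto simp: line_def sel_def)
  moreover then have "p \<bullet> a t \<le> q \<bullet> a t"
    using assms width_pos [of t] by (simp add: price_column)
  ultimately show "t \<in> line d p" by (auto simp: line_def sel_def)
qed

lemma line_chain: "line d p \<subseteq> line d q \<or> line d q \<subseteq> line d p"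
  using line_antimono [of p d q] line_antimono [of q d p] by linarith

lemma line_subset: "line d p \<subseteq> {t \<in> {1..n}. dir t = d}"
  by (auto simp: line_def sel_def)

lemma line_subset_columns: "line d p \<subseteq> {1..n}"
  using line_subset by blast

lemma finite_line [simp]: "finite (line d p)"
  by (simp add: line_def)

lemma sel_eq_lines: "sel p = (\<Union>d\<in>dirs. line d p)"
  by (auto simp: line_def dirs_def sel_def)

text \<open>Loads depend on a choice of columns only through its total width per direction, so
  rounding has to control one number per line.\<close>

lemma load_lines:
  assumes G: "\<And>d. d \<in> dirs \<Longrightarrow> G d \<subseteq> {t \<in> {1..n}. dir t = d}" and i: "i < m"
  shows "load i (\<Union>d\<in>dirs. G d) = (\<Sum>d\<in>dirs. sum width (G d) * d $ i)"
proof -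
  have "load i (\<Union>d\<in>dirs. G d) = (\<Sum>d\<in>dirs. load i (G d))"
    unfolding load_def
  proof (rule sum.UNION_disjoint)
    show "\<forall>d\<in>dirs. finite (G d)"
      using finite_subset [OF G] by simp
    show "\<forall>d\<in>dirs. \<forall>e\<in>dirs. d \<noteq> e \<longrightarrow> G d \<inter> G e = {}" using G by blast
  qed (rule dirs_facts)
  also have "\<dots> = (\<Sum>d\<in>dirs. sum width (G d) * d $ i)"
  proof (intro sum.cong refl)
    fix d assume d: "d \<in> dirs"
    have "a t $ i = width t * d $ i" if "t \<in> G d" for t using G [OF d] that i column_eq by auto
    then show "load i (G d) = sum width (G d) * d $ i" by (simp add: load_def sum_distrib_right)
  qed
  finally show ?thesis .
qed

lemma width_mono: "X \<subseteq> Y \<Longrightarrow> Y \<subseteq> {1..n} \<Longrightarrow> sum width X \<le> sum width Y"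
  using width_pos less_imp_le by (intro sum_mono2) (blast intro: finite_subset)+

text \<open>On a line the selected columns form a chain of initial segments in the order of decreasing
  \<open>\<pi> t / width t\<close>.  A profile records the total width of each of them, rounded down to a multiple
  of \<open>\<eta>\<close> and truncated at \<open>N * \<eta>\<close>; membership of \<open>(d, k)\<close> is monotone in \<open>price p d\<close>.\<close>

definition profile :: "real \<Rightarrow> nat \<Rightarrow> real vec \<Rightarrow> (real vec \<times> nat) set" where
  "profile \<eta> N p = {(d, k). d \<in> dirs \<and> k \<in> {1..N} \<and> real k * \<eta> \<le> sum width (line d p)}"

text \<open>In a profile with positive \<open>\<eta>\<close> the \<open>k\<close> that occur with
  \<open>d\<close> form an initial segment of the positive integers, so their number is the
  truncated, rounded-down width in units of \<open>\<eta>\<close>.\<close>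

definition level :: "(real vec \<times> nat) set \<Rightarrow> real vec \<Rightarrow> nat" where
  "level T d = card {k. (d, k) \<in> T}"

text \<open>A shattered set of more than \<open>m\<close> pairs has linearly dependent directions.
  Let \<open>p\<close> realize the pairs with positive coefficient and \<open>q\<close> those with
  negative one. Membership is monotone in the price, so the dependence, paired with
  \<open>p - q\<close>, has only nonpositive terms, not all zero; yet its sum is 0. The
  Sauer--Shelah lemma then bounds the number of profiles independently of \<open>n\<close>.\<close>

lemma card_profiles_le:
  shows "finite (range (profile \<eta> N))" and "card (range (profile \<eta> N)) \<le> (card dirs * N + 1) ^ m"
proof -
  let ?X = "dirs \<times> {1..N}"
  have finX: "finite ?X" using dirs_facts by auto
  have sub: "range (profile \<eta> N) \<subseteq> Pow ?X" by (auto simp: profile_def)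
  then show "finite (range (profile \<eta> N))" using finX finite_subset by blast
  have mono: "(d, k) \<in> profile \<eta> N q" if "(d, k) \<in> profile \<eta> N p" "price q d \<le> price p d" for d k p q
    using that width_mono [OF line_antimono [OF that(2)] line_subset_columns] by (auto simp: profile_def)
  have small: "card A \<le> m" if A: "A \<subseteq> ?X" "shatters (range (profile \<eta> N)) A" for A
  proof (rule ccontr)
    assume "\<not> card A \<le> m"
    then have mA: "m < card A" by simp
    have finA: "finite A" using A finX finite_subset by blast
    have "fst x \<in> carrier_vec m" if "x \<in> A" for x using that A(1) dirs_facts(2) by auto
    then obtain c where c: "\<exists>x\<in>A. c x \<noteq> 0" "\<And>i. i < m \<Longrightarrow> (\<Sum>x\<in>A. c x * fst x $ i) = (0::real)"
      using vec_linear_dependence [OF finA mA, of fst] by blast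
    obtain p where p: "profile \<eta> N p \<inter> A = {x\<in>A. 0 < c x}"
      using A(2) unfolding shatters_def by (metis (no_types, lifting) imageE mem_Collect_eq subsetI)
    obtain q where q: "profile \<eta> N q \<inter> A = {x\<in>A. c x < 0}"
      using A(2) unfolding shatters_def by (metis (no_types, lifting) imageE mem_Collect_eq subsetI)
    have neg: "c x * (price p (fst x) - price q (fst x)) < 0" if x: "x \<in> A" "c x \<noteq> 0" for x
    proof (cases "0 < c x")
      case True
      then have "x \<in> profile \<eta> N p \<inter> A" "x \<notin> profile \<eta> N q \<inter> A" unfolding p q using x by simp_all
      then have "x \<in> profile \<eta> N p" "x \<notin> profile \<eta> N q" using x by simp_all
      then have "price p (fst x) < price q (fst x)" using mono [of "fst x" "snd x" p q] by force
      then show ?thesis using True by (simp add: mult_pos_neg)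
    next
      case False
      then have "x \<in> profile \<eta> N q \<inter> A" "x \<notin> profile \<eta> N p \<inter> A" unfolding p q using x by simp_all
      then have "x \<in> profile \<eta> N q" "x \<notin> profile \<eta> N p" using x by simp_all
      then have "price q (fst x) < price p (fst x)" using mono [of "fst x" "snd x" q p] by force
      then show ?thesis using False x by (simp add: mult_neg_pos)
    qed
    have "(\<Sum>x\<in>A. c x * (price p (fst x) - price q (fst x))) < (\<Sum>x\<in>A. 0)"
    proof (rule sum_strict_mono_ex1)
      show "\<forall>x\<in>A. c x * (price p (fst x) - price q (fst x)) \<le> 0" using neg by force
      show "\<exists>x\<in>A. c x * (price p (fst x) - price q (fst x)) < 0" using neg c(1) by blast
    qed (rule finA)
    \<comment> \<open>The price is linear in the direction, so the dependence carries over
      coordinate by coordinate.\<close>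
    moreover have "(\<Sum>x\<in>A. c x * (price p (fst x) - price q (fst x))) = 0"
    proof -
      have "(\<Sum>x\<in>A. c x * (price p (fst x) - price q (fst x)))
          = (\<Sum>x\<in>A. \<Sum>i<m. (p $ i - q $ i) * (c x * fst x $ i))"
        by (simp add: price_def sum_subtractf [symmetric] sum_distrib_left algebra_simps)
      also have "\<dots> = (\<Sum>i<m. (p $ i - q $ i) * (\<Sum>x\<in>A. c x * fst x $ i))"
        by (subst sum.swap) (simp add: sum_distrib_left)
      also have "\<dots> = 0" using c(2) by simp
      finally show ?thesis .
    qed
    ultimately show False by simp
  qed
  have "card (range (profile \<eta> N)) \<le> card {A. A \<subseteq> ?X \<and> shatters (range (profile \<eta> N)) A}"
    by (rule card_le_card_shattered [OF finX sub])
  also have "\<dots> \<le> card {A. A \<subseteq> ?X \<and> card A \<le> m}"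
    using small finX by (intro card_mono) auto
  also have "\<dots> \<le> (card ?X + 1) ^ m" by (rule card_subsets_card_le [OF finX])
  finally show "card (range (profile \<eta> N)) \<le> (card dirs * N + 1) ^ m" by (simp add: card_cartesian_product)
qed

text \<open>The level is the floor of \<open>sum width (line d p) / \<eta>\<close> cut off at
  \<open>N\<close>; at the cutoff the upper bound on the width is lost.\<close>

lemma level_profile:
  fixes p :: "real vec" and N :: nat
  assumes "0 < \<eta>" "d \<in> dirs"
  defines "l \<equiv> level (profile \<eta> N p) d"
  shows "l \<le> N" "real l * \<eta> \<le> sum width (line d p)" "l < N \<Longrightarrow> sum width (line d p) < (real l + 1) * \<eta>"
proof -
  let ?w = "sum width (line d p)"
  have "0 \<le> ?w" using width_mono [OF empty_subsetI line_subset_columns, of d p] by simp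
  then have w: "0 \<le> ?w / \<eta>" using assms by simp
  have "{k. (d, k) \<in> profile \<eta> N p} = {1..min N (nat \<lfloor>?w / \<eta>\<rfloor>)}"
    using assms(1,2) w by (auto simp: profile_def le_nat_iff le_floor_iff pos_le_divide_eq)
  then have l: "l = min N (nat \<lfloor>?w / \<eta>\<rfloor>)" by (simp add: l_def level_def)
  then show "l \<le> N" by simp
  have "real (nat \<lfloor>?w / \<eta>\<rfloor>) \<le> ?w / \<eta>" using w by (simp add: of_nat_nat)
  then have "real l \<le> ?w / \<eta>" using l by linarith
  then show "real l * \<eta> \<le> ?w" using assms(1) by (simp add: pos_le_divide_eq)
  assume "l < N"
  then have "real l = of_int \<lfloor>?w / \<eta>\<rfloor>" using l w by (simp add: of_nat_nat)
  then have "?w / \<eta> < real l + 1" by linarith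
  then show "?w < (real l + 1) * \<eta>" using assms(1) by (simp add: pos_divide_less_eq)
qed

section \<open>Inner and outer approximation of the selected set\<close>

text \<open>For a profile \<open>T\<close>, the smallest segment of direction \<open>d\<close> that
  reaches the recorded width. It is determined by \<open>T\<close>, so the union bound can run over
  profiles instead of price vectors.\<close>

definition lower_lines :: "real \<Rightarrow> (real vec \<times> nat) set \<Rightarrow> real vec \<Rightarrow> nat set" where
  "lower_lines \<eta> T d = \<Inter>{line d q |q. real (level T d) * \<eta> \<le> sum width (line d q)}"

text \<open>For a profile \<open>T\<close>, the largest segment below the next multiple of
  \<open>\<eta>\<close>; below the cutoff it contains the segment that gave rise to
  \<open>T\<close>.\<close>

definition upper_lines :: "real \<Rightarrow> (real vec \<times> nat) set \<Rightarrow> real vec \<Rightarrow> nat set" where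
  "upper_lines \<eta> T d = \<Union>{line d q |q. sum width (line d q) < (real (level T d) + 1) * \<eta>}"

definition lower :: "real \<Rightarrow> (real vec \<times> nat) set \<Rightarrow> nat set" where
  "lower \<eta> T = (\<Union>d\<in>dirs. lower_lines \<eta> T d)"

definition upper :: "real \<Rightarrow> (real vec \<times> nat) set \<Rightarrow> nat set" where
  "upper \<eta> T = (\<Union>d\<in>dirs. upper_lines \<eta> T d)"

lemma finite_lines: "finite {line d q |q. Q q}"
  by (rule finite_subset [of _ "Pow {1..n}"]) (auto simp: line_def sel_def)

lemma lower_lines_props:
  fixes p :: "real vec" and N :: nat
  assumes "0 < \<eta>" "d \<in> dirs"
  defines "T \<equiv> profile \<eta> N p"
  shows "lower_lines \<eta> T d \<subseteq> line d p" "real (level T d) * \<eta> \<le> sum width (lower_lines \<eta> T d)"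
proof -
  let ?F = "{line d q |q. real (level T d) * \<eta> \<le> sum width (line d q)}"
  have p: "line d p \<in> ?F" using level_profile(2) [OF assms(1,2), of N p] unfolding T_def by blast
  then show "lower_lines \<eta> T d \<subseteq> line d p" unfolding lower_lines_def by blast
  have "\<Inter>?F \<in> ?F"
  proof (rule finite_chain_Inter_Union_in(1) [OF finite_lines])
    show "?F \<noteq> {}" using p by blast
    show "X \<subseteq> Y \<or> Y \<subseteq> X" if "X \<in> ?F" "Y \<in> ?F" for X Y
    proof -
      obtain q r where "X = line d q" "Y = line d r" using \<open>X \<in> ?F\<close> \<open>Y \<in> ?F\<close> by blast
      then show ?thesis using line_chain [of d q r] by simp
    qed
  qed
  then show "real (level T d) * \<eta> \<le> sum width (lower_lines \<eta> T d)" unfolding lower_lines_def by auto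
qed

lemma upper_lines_props:
  fixes p :: "real vec" and N :: nat
  assumes "0 < \<eta>" "d \<in> dirs"
  defines "T \<equiv> profile \<eta> N p"
  assumes "level T d < N"
  shows "line d p \<subseteq> upper_lines \<eta> T d" "sum width (upper_lines \<eta> T d) < (real (level T d) + 1) * \<eta>"
proof -
  let ?F = "{line d q |q. sum width (line d q) < (real (level T d) + 1) * \<eta>}"
  have p: "line d p \<in> ?F" using level_profile(3) [OF assms(1,2), of N p] assms(4) unfolding T_def by blast
  then show "line d p \<subseteq> upper_lines \<eta> T d" unfolding upper_lines_def by blast
  have "\<Union>?F \<in> ?F"
  proof (rule finite_chain_Inter_Union_in(2) [OF finite_lines])
    show "?F \<noteq> {}" using p by blast
    show "X \<subseteq> Y \<or> Y \<subseteq> X" if "X \<in> ?F" "Y \<in> ?F" for X Y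
    proof -
      obtain q r where "X = line d q" "Y = line d r" using \<open>X \<in> ?F\<close> \<open>Y \<in> ?F\<close> by blast
      then show ?thesis using line_chain [of d q r] by simp
    qed
  qed
  then show "sum width (upper_lines \<eta> T d) < (real (level T d) + 1) * \<eta>" unfolding upper_lines_def by auto
qed

lemma upper_lines_subset: "upper_lines \<eta> T d \<subseteq> {t \<in> {1..n}. dir t = d}"
  using line_subset [of d] unfolding upper_lines_def by blast

lemma upper_subset: "upper \<eta> T \<subseteq> {1..n}"
  using upper_lines_subset unfolding upper_def by blast

lemma lower_subset:
  assumes "0 < \<eta>"
  shows "lower \<eta> (profile \<eta> N p) \<subseteq> sel p"
  unfolding lower_def sel_eq_lines using lower_lines_props(1) [OF assms, of _ N p] by blast

text \<open>The entries of a direction are at most 1, so an excess width of \<open>\<eta>\<close> on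
  a line adds at most \<open>\<eta>\<close> to any load.\<close>

lemma load_lines_diff:
  assumes G: "\<And>d. d \<in> dirs \<Longrightarrow> G d \<subseteq> {t \<in> {1..n}. dir t = d}"
    and H: "\<And>d. d \<in> dirs \<Longrightarrow> H d \<subseteq> {t \<in> {1..n}. dir t = d}"
    and le: "\<And>d. d \<in> dirs \<Longrightarrow> sum width (G d) \<le> sum width (H d) + \<eta>"
    and i: "i < m" and \<eta>: "0 \<le> \<eta>"
  shows "load i (\<Union>d\<in>dirs. G d) \<le> load i (\<Union>d\<in>dirs. H d) + real (card dirs) * \<eta>"
proof -
  have "(\<Sum>d\<in>dirs. sum width (G d) * d $ i) \<le> (\<Sum>d\<in>dirs. sum width (H d) * d $ i + \<eta>)"
  proof (rule sum_mono)
    fix d assume d: "d \<in> dirs"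
    have "sum width (G d) * d $ i \<le> (sum width (H d) + \<eta>) * d $ i"
      using le [OF d] dirs_facts(3) [OF d i] by (intro mult_right_mono) auto
    also have "\<dots> \<le> sum width (H d) * d $ i + \<eta>"
      using dirs_facts(3) [OF d i] \<eta> by (simp add: distrib_right mult_left_le)
    finally show "sum width (G d) * d $ i \<le> sum width (H d) * d $ i + \<eta>" .
  qed
  then show ?thesis using G H i by (simp add: load_lines sum.distrib)
qed

text \<open>At a coordinate where the direction has entry 1, the load of a segment is its width; a
  wide segment thus forces a large load somewhere.\<close>

lemma load_ge_width_line:
  assumes "G \<subseteq> {t \<in> {1..n}. dir t = d}" "G \<subseteq> Y" "Y \<subseteq> {1..n}" "d \<in> dirs"
  obtains i where "i < m" "sum width G \<le> load i Y"
proof -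
  obtain i where i: "i < m" "d $ i = 1" using dirs_facts(4) [OF assms(4)] by auto
  have "sum width G = load i G"
    unfolding load_def using assms(1) column_eq [OF _ i(1)] i(2) by (intro sum.cong) auto
  also have "\<dots> \<le> load i Y" using load_mono i(1) assms by auto
  finally show thesis using that i by blast
qed

text \<open>If some line is at the cutoff, its lower segment alone loads some constraint
  \<open>j\<close>, possibly different from \<open>i\<close>, with \<open>N * \<eta>\<close>.
  Otherwise every line loses at most \<open>\<eta>\<close>.\<close>

lemma load_lower:
  fixes p :: "real vec" and N :: nat
  assumes \<eta>: "0 < \<eta>" and i: "i < m"
  defines "T \<equiv> profile \<eta> N p"
  obtains (truncated) j where "j < m" "real N * \<eta> \<le> load j (lower \<eta> T)"
    | (close) "load i (sel p) \<le> load i (lower \<eta> T) + real (card dirs) * \<eta>"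
proof (cases "\<exists>d\<in>dirs. level T d = N")
  case True
  then obtain d where d: "d \<in> dirs" "level T d = N" by auto
  have low: "lower_lines \<eta> T d \<subseteq> {t \<in> {1..n}. dir t = d}"
    using lower_lines_props(1) [OF \<eta> d(1), of N p] line_subset [of d p] unfolding T_def by blast
  have sub: "lower_lines \<eta> T d \<subseteq> lower \<eta> T" "lower \<eta> T \<subseteq> {1..n}"
    using d lower_subset [OF \<eta>, of N p] sel_subset unfolding lower_def T_def by blast+
  obtain j where "j < m" "sum width (lower_lines \<eta> T d) \<le> load j (lower \<eta> T)"
    by (rule load_ge_width_line [OF low sub d(1)])
  moreover have "real N * \<eta> \<le> sum width (lower_lines \<eta> T d)"
    using lower_lines_props(2) [OF \<eta> d(1), of N p] d(2) unfolding T_def by simp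
  ultimately show thesis using truncated by force
next
  case False
  have "load i (sel p) \<le> load i (lower \<eta> T) + real (card dirs) * \<eta>"
    unfolding sel_eq_lines lower_def
  proof (rule load_lines_diff)
    fix d assume d: "d \<in> dirs"
    show "lower_lines \<eta> T d \<subseteq> {t \<in> {1..n}. dir t = d}"
      using lower_lines_props(1) [OF \<eta> d(1), of N p] line_subset [of d p] unfolding T_def by blast
    have "level T d < N" using False d level_profile(1) [OF \<eta> d, of N p] unfolding T_def by force
    then show "sum width (line d p) \<le> sum width (lower_lines \<eta> T d) + \<eta>"
      using level_profile(3) [OF \<eta> d, of N p] lower_lines_props(2) [OF \<eta> d, of N p]
      unfolding T_def by (simp add: algebra_simps)
  qed (use \<eta> i line_subset in auto)
  then show thesis by (rule close)
qed

lemma load_upper: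
  fixes p :: "real vec" and N :: nat
  assumes \<eta>: "0 < \<eta>" and i: "i < m" and small: "\<And>j. j < m \<Longrightarrow> load j (sel p) < real N * \<eta>"
  defines "T \<equiv> profile \<eta> N p"
  shows "sel p \<subseteq> upper \<eta> T" "load i (upper \<eta> T) \<le> load i (sel p) + real (card dirs) * \<eta>"
proof -
  \<comment> \<open>A line at the cutoff would load some constraint with at least
    \<open>N * \<eta>\<close>, against \<open>small\<close>.\<close>
  have lev: "level T d < N" if d: "d \<in> dirs" for d
  proof -
    obtain j where "j < m" "sum width (line d p) \<le> load j (sel p)"
      by (rule load_ge_width_line [OF line_subset _ sel_subset d, of p p]) (use line_def in auto)
    then have "sum width (line d p) < real N * \<eta>" using small by force
    then have "real (level T d) * \<eta> < real N * \<eta>" using level_profile(2) [OF \<eta> d, of N p] unfolding T_def by linarith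
    then show ?thesis using \<eta> by simp
  qed
  note U = upper_lines_props [OF \<eta> _ lev [unfolded T_def], folded T_def]
  show "sel p \<subseteq> upper \<eta> T" unfolding sel_eq_lines upper_def using U(1) by blast
  show "load i (upper \<eta> T) \<le> load i (sel p) + real (card dirs) * \<eta>"
    unfolding sel_eq_lines upper_def
  proof (rule load_lines_diff)
    fix d assume d: "d \<in> dirs"
    show "sum width (upper_lines \<eta> T d) \<le> sum width (line d p) + \<eta>"
      using level_profile(2) [OF \<eta> d, of N p] U(2) [OF d d] unfolding T_def by (simp add: algebra_simps)
  qed (use \<eta> i line_subset upper_lines_subset in auto)
qed

section \<open>The value of the pricing solution\<close>

lemma feasible_zero: "feasible (\<lambda>_. 0)"
  using B_pos by (auto simp: feasible_def)

lemma val_le: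
  assumes "feasible x"
  shows "val x \<le> (\<Sum>t = 1..n. \<pi> t)" "0 \<le> val x"
  using assms reward_nonneg unfolding val_def
  by (auto simp: feasible_def mult_left_le intro!: sum_mono sum_nonneg)

lemma val_le_OPT: "feasible x \<Longrightarrow> val x \<le> OPT"
  unfolding OPT_def using val_le(1) by (intro cSUP_upper) (auto intro!: bdd_aboveI2)

lemma OPT_le: "(\<And>x. feasible x \<Longrightarrow> val x \<le> c) \<Longrightarrow> OPT \<le> c"
  unfolding OPT_def using feasible_zero by (intro cSUP_least) auto

lemma OPT_nonneg: "0 \<le> OPT"
  using val_le_OPT [OF feasible_zero] by (simp add: val_def)

section \<open>The run of the algorithm\<close>

lemma feasible_run: "feasible (fst (run s \<sigma> p t))"
  by (induction t) (auto simp: feasible_zero Let_def simp del: fun_upd_apply split: prod.splits)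

lemma feasible_pricing_restrict:
  assumes "\<And>i. i < m \<Longrightarrow> load i (sel p) \<le> B"
  shows "feasible (\<lambda>u. if u \<in> U then pricing p u else 0)"
  unfolding feasible_def
proof (intro conjI allI impI ballI)
  fix i assume i: "i < m"
  have "(\<Sum>t = 1..n. a t $ i * (if t \<in> U then pricing p t else 0)) = (\<Sum>t\<in>{1..n} \<inter> U. a t $ i * pricing p t)"
    by (subst sum.inter_restrict) (auto intro: sum.cong)
  also have "\<dots> = load i (sel p \<inter> ({1..n} \<inter> U))" by (rule load_pricing) auto
  also have "\<dots> \<le> load i (sel p)" by (rule load_mono [OF i _ sel_subset]) auto
  finally show "(\<Sum>t = 1..n. a t $ i * (if t \<in> U then pricing p t else 0)) \<le> B" using assms [OF i] by linarith
qed (auto simp: pricing_def)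

text \<open>If \<open>pricing p\<close> satisfies all constraints, so does every restriction of it;
  the flag never drops and every arrival after \<open>s\<close> gets its value under
  \<open>pricing p\<close>.\<close>

lemma run_pricing:
  assumes "\<And>i. i < m \<Longrightarrow> load i (sel p) \<le> B"
  shows "run s \<sigma> p t = ((\<lambda>u. if u \<in> \<sigma> ` {s<..t} then pricing p u else 0), True)"
proof (induction t)
  case (Suc t)
  show ?case
  proof (cases "Suc t \<le> s")
    case False
    then have "{s<..Suc t} = insert (Suc t) {s<..t}" by auto
    then have "(\<lambda>u. if u \<in> \<sigma> ` {s<..t} then pricing p u else 0)(\<sigma> (Suc t) := pricing p (\<sigma> (Suc t)))
       = (\<lambda>u. if u \<in> \<sigma> ` {s<..Suc t} then pricing p u else 0)" by auto
    then show ?thesis using Suc False feasible_pricing_restrict [OF assms] by simp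
  qed (use Suc in simp)
qed simp

lemma val_run_pricing:
  assumes "\<And>i. i < m \<Longrightarrow> load i (sel p) \<le> B" and \<sigma>: "\<sigma> permutes {1..n}" and s: "s \<le> n"
  shows "val (fst (run s \<sigma> p n)) = val (pricing p) - (\<Sum>t\<in>sel p \<inter> \<sigma> ` {1..s}. \<pi> t)"
proof -
  have S: "\<sigma> ` {1..s} \<subseteq> {1..n}" using sample_props [OF \<sigma> s] by auto
  have "{s<..n} = {1..n} - {1..s}" using s by auto
  then have rest: "\<sigma> ` {s<..n} = {1..n} - \<sigma> ` {1..s}"
    using \<sigma> by (simp add: image_set_diff permutes_inj permutes_image)
  have run: "run s \<sigma> p n = ((\<lambda>u. if u \<in> \<sigma> ` {s<..n} then pricing p u else 0), True)"
    using assms(1) by (rule run_pricing)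
  have "val (fst (run s \<sigma> p n)) = (\<Sum>t = 1..n. \<pi> t * pricing p t - (if t \<in> \<sigma> ` {1..s} then \<pi> t * pricing p t else 0))"
    unfolding val_def run fst_conv rest by (intro sum.cong) auto
  also have "\<dots> = val (pricing p) - (\<Sum>t\<in>{1..n} \<inter> \<sigma> ` {1..s}. \<pi> t * pricing p t)"
    by (simp only: sum_subtractf val_def sum.inter_restrict finite_atLeastAtMost)
  also have "{1..n} \<inter> \<sigma> ` {1..s} = \<sigma> ` {1..s}" using S by blast
  also have "(\<Sum>t\<in>\<sigma> ` {1..s}. \<pi> t * pricing p t) = (\<Sum>t\<in>\<sigma> ` {1..s}. if t \<in> sel p then \<pi> t else 0)"
    using S pricing_eq by (intro sum.cong) auto
  also have "\<dots> = (\<Sum>t\<in>sel p \<inter> \<sigma> ` {1..s}. \<pi> t)"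
    by (simp add: sum.inter_restrict [symmetric] Int_commute)
  finally show ?thesis .
qed

text \<open>Approximate complementary slackness: \<open>pricing p\<close> nearly exhausts every constraint with a
  positive price.\<close>

lemma val_pricing_ge:
  assumes p: "\<And>i. i < m \<Longrightarrow> 0 \<le> p $ i"
    and tight: "\<And>i. i < m \<Longrightarrow> 0 < p $ i \<Longrightarrow> (1 - \<kappa>) * B \<le> load i (sel p)"
    and \<kappa>: "0 \<le> \<kappa>" "\<kappa> \<le> 1" and y: "feasible y"
  shows "(1 - \<kappa>) * val y \<le> val (pricing p)"
proof -
  \<comment> \<open>Lagrangian decomposition into reduced rewards and priced loads; for feasible
    \<open>y\<close> it yields weak duality, for \<open>pricing p\<close> an identity with the
    surpluses.\<close>
  have split: "val x = (\<Sum>t = 1..n. (\<pi> t - p \<bullet> a t) * x t) + (\<Sum>i<m. p $ i * (\<Sum>t = 1..n. a t $ i * x t))" for x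
  proof -
    have "(\<Sum>i<m. p $ i * (\<Sum>t = 1..n. a t $ i * x t)) = (\<Sum>t = 1..n. (p \<bullet> a t) * x t)"
      by (simp only: sum_distrib_left sum_distrib_right, subst sum.swap)
        (simp add: scalar_prod_column sum_distrib_left sum_distrib_right mult_ac)
    then show ?thesis by (simp add: val_def left_diff_distrib sum_subtractf)
  qed
  have "val y \<le> (\<Sum>t = 1..n. surplus p t) + B * (\<Sum>i<m. p $ i)"
    unfolding split [of y]
  proof (intro add_mono)
    show "(\<Sum>t = 1..n. (\<pi> t - p \<bullet> a t) * y t) \<le> (\<Sum>t = 1..n. surplus p t)"
    proof (rule sum_mono)
      fix t assume "t \<in> {1..n}"
      then have "0 \<le> y t" "y t \<le> 1" using y by (auto simp: feasible_def)
      then have "(\<pi> t - p \<bullet> a t) * y t \<le> surplus p t * y t" by (intro mult_right_mono) (auto simp: surplus_def)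
      also have "\<dots> \<le> surplus p t" using \<open>0 \<le> y t\<close> \<open>y t \<le> 1\<close> by (intro mult_left_le) (auto simp: surplus_def)
      finally show "(\<pi> t - p \<bullet> a t) * y t \<le> surplus p t" .
    qed
    show "(\<Sum>i<m. p $ i * (\<Sum>t = 1..n. a t $ i * y t)) \<le> B * (\<Sum>i<m. p $ i)"
      unfolding sum_distrib_left [of B] using p y
      by (intro sum_mono) (auto simp: feasible_def mult.commute [of B] intro!: mult_left_mono)
  qed
  then have "(1 - \<kappa>) * val y \<le> (1 - \<kappa>) * (\<Sum>t = 1..n. surplus p t) + (1 - \<kappa>) * B * (\<Sum>i<m. p $ i)"
    using \<kappa> by (metis (no_types, lifting) diff_ge_0_iff_ge distrib_left mult.assoc mult_left_mono)
  also have "\<dots> \<le> (\<Sum>t = 1..n. surplus p t) + (\<Sum>i<m. p $ i * load i (sel p))"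
  proof (intro add_mono)
    show "(1 - \<kappa>) * (\<Sum>t = 1..n. surplus p t) \<le> (\<Sum>t = 1..n. surplus p t)"
      using \<kappa> by (intro mult_left_le_one_le) (auto simp: surplus_def intro!: sum_nonneg)
    show "(1 - \<kappa>) * B * (\<Sum>i<m. p $ i) \<le> (\<Sum>i<m. p $ i * load i (sel p))"
      unfolding sum_distrib_left
    proof (rule sum_mono)
      fix i assume "i \<in> {..<m}"
      then show "(1 - \<kappa>) * B * p $ i \<le> p $ i * load i (sel p)"
        using p [of i] tight [of i] by (cases "p $ i = 0") (auto simp: mult.commute)
    qed
  qed
  also have "\<dots> = val (pricing p)"
  proof -
    \<comment> \<open>\<open>pricing p\<close> takes exactly the columns with positive reduced
      reward.\<close>
    have "(\<pi> t - p \<bullet> a t) * pricing p t = surplus p t" if "t \<in> {1..n}" for t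
      by (auto simp: pricing_def surplus_def)
    moreover have "(\<Sum>t = 1..n. a t $ i * pricing p t) = load i (sel p)" for i
      using load_pricing [OF order_refl, of i p] sel_subset [of p] by (simp add: Int_absorb2)
    ultimately show ?thesis unfolding split [of "pricing p"] by simp
  qed
  finally show ?thesis .
qed

text \<open>Averaging the sample solutions over all orders and scaling by \<open>n / s\<close> gives a feasible
  solution of the full problem.\<close>

lemma sample_value_le:
  assumes s: "0 < s" "s \<le> n" and \<delta>: "\<delta> \<le> 1"
    and Q: "\<And>\<sigma> i. \<sigma> permutes {1..n} \<Longrightarrow> i < m \<Longrightarrow> load i (sel (Q \<sigma>) \<inter> \<sigma> ` {1..s}) \<le> real s / real n * \<delta> * B"
  shows "(\<Sum>\<sigma> | \<sigma> permutes {1..n}. \<Sum>t\<in>sel (Q \<sigma>) \<inter> \<sigma> ` {1..s}. \<pi> t) \<le> fact n * (real s / real n) * OPT"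
proof -
  let ?P = "{\<sigma>. \<sigma> permutes {1..n}}"
  \<comment> \<open>By symmetry, the number of orders that put a given column into the sample; hence
    \<open>z t\<close> is at most 1.\<close>
  define D where "D = (fact n * (real s / real n) :: real)"
  have D: "0 < D" using s n_pos by (simp add: D_def)
  have finP: "finite ?P" by (rule finite_permutations) simp
  have cardP: "card ?P = fact n" using card_permutations [of "{1..n}" n] by simp
  define X where "X = (\<lambda>\<sigma>. sel (Q \<sigma>) \<inter> \<sigma> ` {1..s})"
  define z where "z = (\<lambda>t. (\<Sum>\<sigma>\<in>?P. if t \<in> X \<sigma> then 1 else 0) / D)"
  have X: "X \<sigma> \<subseteq> {1..n}" "{1..n} \<inter> X \<sigma> = X \<sigma>" for \<sigma> using sel_subset by (auto simp: X_def)
  have avg: "(\<Sum>t = 1..n. f t * z t) = (\<Sum>\<sigma>\<in>?P. \<Sum>t\<in>X \<sigma>. f t) / D" for f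
  proof -
    have "(\<Sum>t = 1..n. f t * z t) = (\<Sum>t = 1..n. \<Sum>\<sigma>\<in>?P. if t \<in> X \<sigma> then f t else 0) / D"
      unfolding z_def sum_divide_distrib sum_distrib_left times_divide_eq_right
      by (intro sum.cong refl) (simp add: sum_distrib_left if_distrib [of "\<lambda>x. _ * x"] cong: if_cong)
    also have "(\<Sum>t = 1..n. \<Sum>\<sigma>\<in>?P. if t \<in> X \<sigma> then f t else 0) = (\<Sum>\<sigma>\<in>?P. \<Sum>t = 1..n. if t \<in> X \<sigma> then f t else 0)"
      by (rule sum.swap)
    also have "\<dots> = (\<Sum>\<sigma>\<in>?P. \<Sum>t\<in>X \<sigma>. f t)"
      by (simp only: sum.inter_restrict [OF finite_atLeastAtMost, symmetric] X(2))
    finally show ?thesis .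
  qed
  have "feasible z"
    unfolding feasible_def
  proof (intro conjI allI impI ballI)
    fix i assume i: "i < m"
    have "(\<Sum>\<sigma>\<in>?P. load i (X \<sigma>)) \<le> (\<Sum>\<sigma>\<in>?P. real s / real n * B)"
    proof (rule sum_mono)
      fix \<sigma> assume "\<sigma> \<in> ?P"
      then have "load i (X \<sigma>) \<le> real s / real n * \<delta> * B" using Q i by (simp add: X_def)
      also have "\<dots> \<le> real s / real n * B"
        using \<delta> B_pos by (intro mult_right_mono mult_left_le) auto
      finally show "load i (X \<sigma>) \<le> real s / real n * B" .
    qed
    also have "\<dots> = D * B" using cardP by (simp add: D_def)
    finally show "(\<Sum>t = 1..n. a t $ i * z t) \<le> B"
      using D unfolding avg load_def [symmetric] by (simp add: divide_le_eq mult.commute)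
  next
    fix t assume t: "t \<in> {1..n}"
    have "(\<Sum>\<sigma>\<in>?P. if t \<in> X \<sigma> then 1 else 0) = real (card (?P \<inter> {\<sigma>. t \<in> X \<sigma>}))"
      using finP by (simp add: sum.If_cases)
    also have "\<dots> \<le> card {\<sigma>. \<sigma> permutes {1..n} \<and> t \<in> \<sigma> ` {1..s}}"
      using finP by (intro of_nat_mono card_mono) (auto simp: X_def)
    also have "\<dots> = D"
      using card_perms_mem_image [of "{1..n}" "{1..s}" t] t s by (simp add: D_def)
    finally have "(\<Sum>\<sigma>\<in>?P. if t \<in> X \<sigma> then 1 else 0) \<le> D" .
    moreover have "(0::real) \<le> (\<Sum>\<sigma>\<in>?P. if t \<in> X \<sigma> then 1 else 0)" by (intro sum_nonneg) auto
    ultimately show "z t \<in> {0..1}" using D by (simp add: z_def)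
  qed
  then have "(\<Sum>\<sigma>\<in>?P. \<Sum>t\<in>X \<sigma>. \<pi> t) / D \<le> OPT" using val_le_OPT [of z] by (simp only: val_def avg)
  then have "(\<Sum>\<sigma>\<in>?P. \<Sum>t\<in>X \<sigma>. \<pi> t) \<le> D * OPT" using D by (simp add: divide_le_eq mult.commute)
  then show ?thesis unfolding X_def D_def .
qed

section \<open>Tail bounds for the load of a fixed set in the sample\<close>

text \<open>The expected sample load is at least
  \<open>\<epsilon> * (1 - \<epsilon> / 2) * B\<close>, so the event is a relative shortfall of
  order \<open>\<epsilon> / 2\<close>; accordingly the lower tail is used with
  \<open>l = \<epsilon> / 4\<close>.\<close>

lemma card_perms_load_le:
  assumes Y: "Y \<subseteq> {1..n}" and i: "i < m" and \<epsilon>: "0 < \<epsilon>" "\<epsilon> \<le> 1" "real s = \<epsilon> * real n"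
    and L: "(1 - \<epsilon> / 2) * B \<le> load i Y"
  shows "real (card {\<sigma>. \<sigma> permutes {1..n} \<and> load i (Y \<inter> \<sigma> ` {1..s}) \<le> \<epsilon> * (1 - \<epsilon>) * B})
    \<le> fact n * exp (- (\<epsilon> ^ 3 * B / 16))"
proof -
  let ?w = "\<lambda>t. if t \<in> Y then a t $ i else 0"
  have sn: "s \<le> n" using \<epsilon> n_pos by (metis mult_left_le_one_le of_nat_0_le_iff of_nat_le_iff less_imp_le)
  have rate: "real s / real n = \<epsilon>" using \<epsilon>(3) n_pos by simp
  have w: "sum ?w S = load i (Y \<inter> S)" if "finite S" for S
    using that by (simp add: load_def sum.inter_restrict [symmetric] Int_commute)
  have "real (card {\<sigma>. \<sigma> permutes {1..n} \<and> sum ?w (\<sigma> ` {1..s}) \<le> \<epsilon> * (1 - \<epsilon>) * B})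
    \<le> fact (card {1..n}) * exp (\<epsilon> / 4 * (\<epsilon> * (1 - \<epsilon>) * B) - card {1..s} / card {1..n} * (\<epsilon> / 4 - (\<epsilon> / 4)\<^sup>2) * sum ?w {1..n})"
    using \<epsilon> sn n_pos column_01 i by (intro card_perms_sum_le) auto
  also have "sum ?w {1..n} = load i Y" using w [of "{1..n}"] Y by (simp add: Int_absorb2)
  also have "fact (card {1..n}) * exp (\<epsilon> / 4 * (\<epsilon> * (1 - \<epsilon>) * B) - card {1..s} / card {1..n} * (\<epsilon> / 4 - (\<epsilon> / 4)\<^sup>2) * load i Y)
     \<le> fact n * exp (- (\<epsilon> ^ 3 * B / 16))"
  proof -
    have "(\<epsilon> / 4)\<^sup>2 \<le> \<epsilon> / 4" using \<epsilon> by (simp add: power2_eq_square mult_left_le)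
    then have "\<epsilon> * (\<epsilon> / 4 - (\<epsilon> / 4)\<^sup>2) * ((1 - \<epsilon> / 2) * B) \<le> \<epsilon> * (\<epsilon> / 4 - (\<epsilon> / 4)\<^sup>2) * load i Y"
      using L \<epsilon> by (intro mult_left_mono) auto
    moreover have "\<epsilon> / 4 * (\<epsilon> * (1 - \<epsilon>) * B) - \<epsilon> * (\<epsilon> / 4 - (\<epsilon> / 4)\<^sup>2) * ((1 - \<epsilon> / 2) * B) = - (\<epsilon> ^ 3 * B / 16) - \<epsilon> ^ 4 * B / 32"
      by (simp add: power2_eq_square power3_eq_cube power4_eq_xxxx field_simps)
    moreover have "0 \<le> \<epsilon> ^ 4 * B / 32" using B_pos \<epsilon> by simp
    ultimately show ?thesis using rate by simp
  qed
  finally show ?thesis using w by simp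
qed

text \<open>The expected sample load is at most
  \<open>\<epsilon> * (1 - 5 / 2 * \<epsilon>) * B\<close>. The loss of \<open>m\<close> from tied
  columns costs at most \<open>\<epsilon>\<^sup>2 * B / 4\<close>, so an excess of at least
  \<open>5 / 4 * \<epsilon>\<^sup>2 * B\<close> remains. Again
  \<open>l = \<epsilon> / 4\<close>.\<close>

lemma card_perms_load_ge:
  assumes Y: "Y \<subseteq> {1..n}" and i: "i < m" and \<epsilon>: "0 < \<epsilon>" "\<epsilon> \<le> 1" "real s = \<epsilon> * real n"
    and L: "load i Y \<le> (1 - 5 / 2 * \<epsilon>) * B" and mB: "real m \<le> \<epsilon>\<^sup>2 * B / 4"
  shows "real (card {\<sigma>. \<sigma> permutes {1..n} \<and> \<epsilon> * (1 - \<epsilon>) * B - real m \<le> load i (Y \<inter> \<sigma> ` {1..s})})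
    \<le> fact n * exp (- (\<epsilon> ^ 3 * B / 16))"
proof -
  let ?w = "\<lambda>t. if t \<in> Y then a t $ i else 0"
  let ?h = "\<epsilon> * (1 - \<epsilon>) * B - real m"
  have sn: "s \<le> n" using \<epsilon> n_pos by (metis mult_left_le_one_le of_nat_0_le_iff of_nat_le_iff less_imp_le)
  have rate: "real s / real n = \<epsilon>" using \<epsilon>(3) n_pos by simp
  have w: "sum ?w S = load i (Y \<inter> S)" if "finite S" for S
    using that by (simp add: load_def sum.inter_restrict [symmetric] Int_commute)
  have "real (card {\<sigma>. \<sigma> permutes {1..n} \<and> ?h \<le> sum ?w (\<sigma> ` {1..s})})
    \<le> fact (card {1..n}) * exp (card {1..s} / card {1..n} * (\<epsilon> / 4 + (\<epsilon> / 4)\<^sup>2) * sum ?w {1..n} - \<epsilon> / 4 * ?h)"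
    using \<epsilon> sn n_pos column_01 i by (intro card_perms_sum_ge) auto
  also have "sum ?w {1..n} = load i Y" using w [of "{1..n}"] Y by (simp add: Int_absorb2)
  also have "fact (card {1..n}) * exp (card {1..s} / card {1..n} * (\<epsilon> / 4 + (\<epsilon> / 4)\<^sup>2) * load i Y - \<epsilon> / 4 * ?h)
     \<le> fact n * exp (- (\<epsilon> ^ 3 * B / 16))"
  proof -
    have "\<epsilon> * (\<epsilon> / 4 + (\<epsilon> / 4)\<^sup>2) * load i Y \<le> \<epsilon> * (\<epsilon> / 4 + (\<epsilon> / 4)\<^sup>2) * ((1 - 5 / 2 * \<epsilon>) * B)"
      using L \<epsilon> by (intro mult_left_mono) auto
    moreover have "\<epsilon> / 4 * real m \<le> \<epsilon> / 4 * (\<epsilon>\<^sup>2 * B / 4)" using mB \<epsilon> by (intro mult_left_mono) auto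
    moreover have "\<epsilon> * (\<epsilon> / 4 + (\<epsilon> / 4)\<^sup>2) * ((1 - 5 / 2 * \<epsilon>) * B) - \<epsilon> / 4 * (\<epsilon> * (1 - \<epsilon>) * B) + \<epsilon> / 4 * (\<epsilon>\<^sup>2 * B / 4)
        = - (\<epsilon> ^ 3 * B / 4) - 5 / 32 * (\<epsilon> ^ 4 * B)"
      by (simp add: power2_eq_square power3_eq_cube power4_eq_xxxx field_simps)
    moreover have "0 \<le> \<epsilon> ^ 4 * B" "0 \<le> \<epsilon> ^ 3 * B" using B_pos \<epsilon> by auto
    ultimately have "\<epsilon> * (\<epsilon> / 4 + (\<epsilon> / 4)\<^sup>2) * load i Y - \<epsilon> / 4 * ?h \<le> - (\<epsilon> ^ 3 * B / 16)"
      unfolding right_diff_distrib [of "\<epsilon> / 4" _ "real m"] by linarith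
    then show ?thesis using rate by simp
  qed
  finally show ?thesis using w by simp
qed

section \<open>The union bound\<close>

text \<open>The first part lets the run collect all of \<open>pricing p\<close> after the sample;
  the second is the tightness in \<open>val_pricing_ge\<close> with
  \<open>\<kappa> = 3 * \<epsilon>\<close>.\<close>

definition good :: "real \<Rightarrow> real vec \<Rightarrow> bool" where
  "good \<epsilon> p \<longleftrightarrow> (\<forall>i<m. load i (sel p) \<le> B \<and> (0 < p $ i \<longrightarrow> (1 - 3 * \<epsilon>) * B \<le> load i (sel p)))"

text \<open>The computed prices depend on the order, but \<open>lower \<eta> T\<close> and
  \<open>upper \<eta> T\<close> are fixed once \<open>T\<close> is. For an overload the lower set
  inherits the small sample load from dual optimality; for an underload at a positive price the
  upper set inherits the large one. Either way a tail event for a fixed set occurs.\<close>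

lemma card_bad_orders_le:
  fixes N :: nat
  assumes \<epsilon>: "0 < \<epsilon>" "\<epsilon> \<le> 1" "real s = \<epsilon> * real n"
    and dual: "\<And>\<sigma>. \<sigma> permutes {1..n} \<Longrightarrow> \<exists>\<alpha>. dual_optimal s (1 - \<epsilon>) \<sigma> (Q \<sigma>) \<alpha>"
    and mB: "real m \<le> \<epsilon>\<^sup>2 * B / 4"
    and \<eta>: "0 < \<eta>" "B < real N * \<eta>" "real (card dirs) * \<eta> \<le> \<epsilon> / 2 * B"
  shows "real (card {\<sigma>. \<sigma> permutes {1..n} \<and> \<not> good \<epsilon> (Q \<sigma>)})
    \<le> 2 * real m * real ((card dirs * N + 1) ^ m) * (fact n * exp (- (\<epsilon> ^ 3 * B / 16)))"
proof -
  define E where "E = (fact n * exp (- (\<epsilon> ^ 3 * B / 16)) :: real)"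
  define R where "R = range (profile \<eta> N)"
  let ?c = "\<epsilon> * (1 - \<epsilon>) * B"
  \<comment> \<open>The thresholds differ from \<open>B\<close> and
    \<open>(1 - 3 * \<epsilon>) * B\<close> by the rounding error
    \<open>\<epsilon> / 2 * B\<close>.\<close>
  define L where "L = (\<lambda>T i. {\<sigma>. \<sigma> permutes {1..n} \<and> (1 - \<epsilon> / 2) * B \<le> load i (lower \<eta> T)
    \<and> load i (lower \<eta> T \<inter> \<sigma> ` {1..s}) \<le> ?c})"
  define U where "U = (\<lambda>T i. {\<sigma>. \<sigma> permutes {1..n} \<and> load i (upper \<eta> T) \<le> (1 - 5 / 2 * \<epsilon>) * B
    \<and> ?c - real m \<le> load i (upper \<eta> T \<inter> \<sigma> ` {1..s})})"
  have sn: "s \<le> n" using \<epsilon> n_pos by (metis mult_left_le_one_le of_nat_0_le_iff of_nat_le_iff less_imp_le)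
  have rate: "real s / real n = \<epsilon>" using \<epsilon>(3) n_pos by simp
  have R: "finite R" "card R \<le> (card dirs * N + 1) ^ m" using card_profiles_le by (auto simp: R_def)
  have finP: "finite {\<sigma>. \<sigma> permutes {1..n}}" by (rule finite_permutations) simp
  have finLU: "finite (L T i \<union> U T i)" for T i
    by (rule finite_subset [OF _ finP]) (auto simp: L_def U_def)
  have E0: "0 \<le> E" by (simp add: E_def)
  have cardL: "real (card (L T i)) \<le> E" if "T \<in> R" "i < m" for T i
  proof (cases "(1 - \<epsilon> / 2) * B \<le> load i (lower \<eta> T)")
    case True
    have "lower \<eta> T \<subseteq> {1..n}" using that(1) lower_subset [OF \<eta>(1)] sel_subset unfolding R_def by blast
    then show ?thesis using card_perms_load_le [OF _ that(2) \<epsilon> True] True by (simp add: L_def E_def)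
  next
    case False
    then show ?thesis using E0 by (simp add: L_def)
  qed
  have cardU: "real (card (U T i)) \<le> E" if "i < m" for T i
  proof (cases "load i (upper \<eta> T) \<le> (1 - 5 / 2 * \<epsilon>) * B")
    case True
    then show ?thesis using card_perms_load_ge [OF upper_subset that \<epsilon> True mB] by (simp add: U_def E_def)
  next
    case False
    then show ?thesis using E0 by (simp add: U_def)
  qed
  have cover: "{\<sigma>. \<sigma> permutes {1..n} \<and> \<not> good \<epsilon> (Q \<sigma>)} \<subseteq> (\<Union>T\<in>R. \<Union>i<m. L T i \<union> U T i)"
  proof
    fix \<sigma> assume "\<sigma> \<in> {\<sigma>. \<sigma> permutes {1..n} \<and> \<not> good \<epsilon> (Q \<sigma>)}"
    then have \<sigma>: "\<sigma> permutes {1..n}" and bad: "\<not> good \<epsilon> (Q \<sigma>)" by auto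
    define p where "p = Q \<sigma>"
    obtain \<alpha> where opt: "dual_optimal s (1 - \<epsilon>) \<sigma> p \<alpha>" using dual [OF \<sigma>] p_def by auto
    note sample = dual_optimal_load [OF \<sigma> sn opt, unfolded rate]
    define T where "T = profile \<eta> N p"
    have T: "T \<in> R" by (simp add: T_def R_def)
    have S: "\<sigma> ` {1..s} \<subseteq> {1..n}" using sample_props [OF \<sigma> sn] by auto
    have "\<exists>i<m. \<sigma> \<in> L T i \<union> U T i"
    proof (cases "\<exists>i<m. B < load i (sel p)")
      case True
      then obtain i where i: "i < m" "B < load i (sel p)" by auto
      have low: "lower \<eta> T \<subseteq> sel p" unfolding T_def by (rule lower_subset [OF \<eta>(1)])
      \<comment> \<open>Truncation may move the overload from \<open>i\<close> to another constraint
        \<open>j\<close>, which is harmless since the sample bound holds for every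
        constraint.\<close>
      have "\<exists>j<m. (1 - \<epsilon> / 2) * B \<le> load j (lower \<eta> T)"
        using \<eta>(1) i(1)
      proof (cases rule: load_lower [where N = N and p = p])
        case (truncated j)
        have "(1 - \<epsilon> / 2) * B \<le> B" using \<epsilon> B_pos by simp
        then show ?thesis using truncated \<eta>(2) unfolding T_def by (intro exI [of _ j]) linarith
      next
        case close
        then show ?thesis using i \<eta>(3) unfolding T_def
          by (intro exI [of _ i]) (simp add: left_diff_distrib)
      qed
      then obtain j where j: "j < m" "(1 - \<epsilon> / 2) * B \<le> load j (lower \<eta> T)" by auto
      have "load j (lower \<eta> T \<inter> \<sigma> ` {1..s}) \<le> load j (sel p \<inter> \<sigma> ` {1..s})"
        using low S by (intro load_mono j) auto
      also have "\<dots> \<le> ?c" using sample(1) [OF j(1)] .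
      finally show ?thesis using j \<sigma> by (auto simp: L_def)
    next
      case False
      then obtain i where i: "i < m" "0 < p $ i" "load i (sel p) < (1 - 3 * \<epsilon>) * B"
        using bad by (force simp: good_def p_def)
      \<comment> \<open>No constraint is overloaded here, so no line is at the cutoff.\<close>
      have "load j (sel p) < real N * \<eta>" if "j < m" for j using False \<eta>(2) that by force
      note up = load_upper [OF \<eta>(1) i(1) this, folded T_def]
      have "?c - real m \<le> load i (sel p \<inter> \<sigma> ` {1..s})" using sample(2) [OF i(1,2)] .
      also have "\<dots> \<le> load i (upper \<eta> T \<inter> \<sigma> ` {1..s})"
        using up(1) S by (intro load_mono i) auto
      finally have "?c - real m \<le> load i (upper \<eta> T \<inter> \<sigma> ` {1..s})" .
      moreover have "load i (upper \<eta> T) \<le> (1 - 5 / 2 * \<epsilon>) * B"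
        using up(2) i(3) \<eta>(3) by (simp add: left_diff_distrib)
      ultimately show ?thesis using i \<sigma> by (auto simp: U_def)
    qed
    then show "\<sigma> \<in> (\<Union>T\<in>R. \<Union>i<m. L T i \<union> U T i)" using T by blast
  qed
  have "card {\<sigma>. \<sigma> permutes {1..n} \<and> \<not> good \<epsilon> (Q \<sigma>)} \<le> card (\<Union>T\<in>R. \<Union>i<m. L T i \<union> U T i)"
    using R(1) finLU by (intro card_mono cover) blast
  also have "\<dots> \<le> (\<Sum>T\<in>R. card (\<Union>i<m. L T i \<union> U T i))" by (rule card_UN_le [OF R(1)])
  also have "\<dots> \<le> (\<Sum>T\<in>R. \<Sum>i<m. card (L T i \<union> U T i))" by (intro sum_mono card_UN_le) simp
  also have "\<dots> \<le> (\<Sum>T\<in>R. \<Sum>i<m. card (L T i) + card (U T i))" by (intro sum_mono card_Un_le)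
  finally have "real (card {\<sigma>. \<sigma> permutes {1..n} \<and> \<not> good \<epsilon> (Q \<sigma>)})
      \<le> (\<Sum>T\<in>R. \<Sum>i<m. real (card (L T i)) + real (card (U T i)))"
    by (simp flip: of_nat_add of_nat_sum)
  also have "\<dots> \<le> (\<Sum>T\<in>R. \<Sum>i<m. E + E)"
    by (intro sum_mono add_mono cardL cardU) auto
  also have "\<dots> = real (card R) * (2 * real m * E)" by simp
  also have "\<dots> \<le> real ((card dirs * N + 1) ^ m) * (2 * real m * E)"
    using R(2) E0 by (intro mult_right_mono of_nat_mono) auto
  finally show ?thesis by (simp add: E_def mult_ac)
qed

section \<open>Expected value\<close>

text \<open>The loss of \<open>5 * \<epsilon>\<close> consists of \<open>\<epsilon>\<close> for bad
  orders, \<open>3 * \<epsilon>\<close> for incomplete tightness and \<open>\<epsilon>\<close> for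
  the sample. The bound \<open>\<epsilon> \<le> 1 / 5\<close> keeps
  \<open>1 - 3 * \<epsilon>\<close> positive.\<close>

lemma expected_value_ge:
  assumes \<epsilon>: "0 < \<epsilon>" "\<epsilon> \<le> 1 / 5" "real s = \<epsilon> * real n"
    and rule: "dual_rule s (1 - \<epsilon>) P"
    and bad: "real (card {\<sigma>. \<sigma> permutes {1..n} \<and> \<not> good \<epsilon> (P (observed s \<sigma>))}) \<le> \<epsilon> * fact n"
  shows "(1 - 5 * \<epsilon>) * OPT * fact n \<le> (\<Sum>\<sigma> | \<sigma> permutes {1..n}. val (OTP s P \<sigma>))"
proof -
  let ?Perm = "{\<sigma>. \<sigma> permutes {1..n}}"
  define Q where "Q = (\<lambda>\<sigma>. P (observed s \<sigma>))"
  define v where "v = (\<lambda>\<sigma>. \<Sum>t\<in>sel (Q \<sigma>) \<inter> \<sigma> ` {1..s}. \<pi> t)"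
  define Good where "Good = {\<sigma>. \<sigma> permutes {1..n} \<and> good \<epsilon> (Q \<sigma>)}"
  define Bad where "Bad = {\<sigma>. \<sigma> permutes {1..n} \<and> \<not> good \<epsilon> (Q \<sigma>)}"
  have "\<epsilon> * real n \<le> 1 * real n" using \<epsilon>(1,2) by (intro mult_right_mono) auto
  then have "real s \<le> real n" using \<epsilon>(3) by linarith
  then have sn: "s \<le> n" by simp
  have rate: "real s / real n = \<epsilon>" using \<epsilon>(3) n_pos by simp
  have "0 < real s" using \<epsilon> n_pos by simp
  then have s0: "0 < s" by simp
  have finP: "finite ?Perm" by (rule finite_permutations) simp
  have cardP: "card ?Perm = fact n" using card_permutations [of "{1..n}" n] by simp
  have fin: "finite Good" "finite Bad" using finP by (auto simp: Good_def Bad_def)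
  have "?Perm = Good \<union> Bad" "Good \<inter> Bad = {}" by (auto simp: Good_def Bad_def)
  then have "card Good + card Bad = fact n" using card_Un_disjoint [OF fin] cardP by simp
  then have "real (card Good) + real (card Bad) = fact n" by (metis of_nat_add of_nat_fact)
  then have cardG: "(1 - \<epsilon>) * fact n \<le> real (card Good)"
    using bad by (simp add: Bad_def Q_def algebra_simps)
  have opt: "\<exists>\<alpha>. dual_optimal s (1 - \<epsilon>) \<sigma> (Q \<sigma>) \<alpha>" if "\<sigma> permutes {1..n}" for \<sigma>
    using rule that by (auto simp: dual_rule_def Q_def)
  have v0: "0 \<le> v \<sigma>" for \<sigma> unfolding v_def by (intro sum_nonneg) (auto simp: sel_def reward_nonneg)
  have "(\<Sum>\<sigma>\<in>?Perm. v \<sigma>) \<le> fact n * (real s / real n) * OPT"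
    unfolding v_def
  proof (rule sample_value_le [OF s0 sn])
    show "load i (sel (Q \<sigma>) \<inter> \<sigma> ` {1..s}) \<le> real s / real n * (1 - \<epsilon>) * B"
      if "\<sigma> permutes {1..n}" "i < m" for \<sigma> i
      using opt [OF that(1)] dual_optimal_load(1) [OF that(1) sn _ that(2)] by blast
  qed (use \<epsilon> in auto)
  then have sv: "(\<Sum>\<sigma>\<in>?Perm. v \<sigma>) \<le> fact n * \<epsilon> * OPT" by (simp add: rate)
  have each: "(1 - 3 * \<epsilon>) * OPT - v \<sigma> \<le> val (OTP s P \<sigma>)" if "\<sigma> \<in> Good" for \<sigma>
  proof -
    have \<sigma>: "\<sigma> permutes {1..n}" and g: "good \<epsilon> (Q \<sigma>)" using that by (auto simp: Good_def)
    obtain \<alpha> where \<alpha>: "dual_optimal s (1 - \<epsilon>) \<sigma> (Q \<sigma>) \<alpha>" using opt [OF \<sigma>] ..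
    have \<epsilon>3: "0 < 1 - 3 * \<epsilon>" using \<epsilon> by linarith
    have "(1 - 3 * \<epsilon>) * val y \<le> val (pricing (Q \<sigma>))" if "feasible y" for y
      using g dual_optimal_carrier(2) [OF \<alpha>] that \<epsilon> by (intro val_pricing_ge) (auto simp: good_def)
    then have "OPT \<le> val (pricing (Q \<sigma>)) / (1 - 3 * \<epsilon>)"
      using \<epsilon>3 by (intro OPT_le) (simp add: pos_le_divide_eq mult.commute)
    then have "(1 - 3 * \<epsilon>) * OPT \<le> val (pricing (Q \<sigma>))"
      using \<epsilon>3 by (simp add: pos_le_divide_eq mult.commute)
    moreover have "val (OTP s P \<sigma>) = val (pricing (Q \<sigma>)) - v \<sigma>"
    proof -
      have "P (observed s \<sigma>) = Q \<sigma>" by (simp add: Q_def)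
      then show ?thesis
        unfolding OTP_def v_def using g \<sigma> sn by (simp add: val_run_pricing good_def)
    qed
    ultimately show ?thesis by simp
  qed
  have "(1 - 5 * \<epsilon>) * OPT * fact n \<le> (1 - \<epsilon>) * fact n * ((1 - 3 * \<epsilon>) * OPT) - fact n * \<epsilon> * OPT"
  proof -
    have "(1 - \<epsilon>) * fact n * ((1 - 3 * \<epsilon>) * OPT) - fact n * \<epsilon> * OPT - (1 - 5 * \<epsilon>) * OPT * fact n
        = 3 * \<epsilon>\<^sup>2 * (OPT * fact n)" by (simp add: power2_eq_square algebra_simps)
    also have "0 \<le> \<dots>" using OPT_nonneg by simp
    finally show ?thesis by simp
  qed
  also have "\<dots> \<le> real (card Good) * ((1 - 3 * \<epsilon>) * OPT) - (\<Sum>\<sigma>\<in>?Perm. v \<sigma>)"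
    using cardG sv OPT_nonneg \<epsilon> by (intro diff_mono mult_right_mono) auto
  \<comment> \<open>The sample loss is bounded only on average over all orders; being nonnegative,
    it can then be restricted to the good ones.\<close>
  also have "\<dots> \<le> real (card Good) * ((1 - 3 * \<epsilon>) * OPT) - (\<Sum>\<sigma>\<in>Good. v \<sigma>)"
    using v0 finP by (intro diff_mono sum_mono2) (auto simp: Good_def)
  also have "\<dots> = (\<Sum>\<sigma>\<in>Good. (1 - 3 * \<epsilon>) * OPT - v \<sigma>)" by (simp add: sum_subtractf)
  also have "\<dots> \<le> (\<Sum>\<sigma>\<in>Good. val (OTP s P \<sigma>))" by (intro sum_mono each)
  also have "\<dots> \<le> (\<Sum>\<sigma>\<in>?Perm. val (OTP s P \<sigma>))"
    using finP val_le(2) [OF feasible_run] by (intro sum_mono2) (auto simp: Good_def OTP_def)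
  finally show ?thesis .
qed

end

section \<open>Choice of constants and conclusion\<close>

text \<open>With \<open>r = K / \<epsilon>\<close> there are at most \<open>r ^ (3 * m)\<close>
  profiles, while the constant \<open>80 = 16 * 5\<close> makes each failure probability at most
  \<open>1 / r ^ (5 * m)\<close>. The prefactor \<open>2 * m\<close> is at most
  \<open>2 * \<epsilon> * r\<close>, and \<open>2 * r \<le> r ^ (2 * m)\<close> leaves
  \<open>\<epsilon>\<close>.\<close>

lemma union_bound_arith:
  fixes \<epsilon> B :: real and m K k N :: nat
  assumes m: "0 < m" "m \<le> K" and k: "k \<le> K" and \<epsilon>: "0 < \<epsilon>" "\<epsilon> \<le> 1 / 5"
    and N: "real N \<le> 4 * real k / \<epsilon> + 1" and B: "B \<ge> 80 * (real m / \<epsilon> ^ 3) * ln (real K / \<epsilon>)"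
  shows "2 * real m * real ((k * N + 1) ^ m) * exp (- (\<epsilon> ^ 3 * B / 16)) \<le> \<epsilon>" "real m \<le> \<epsilon>\<^sup>2 * B / 4"
proof -
  define r where "r = real K / \<epsilon>"
  have K1: "1 \<le> real K" using m by simp
  have "5 * \<epsilon> \<le> real K" using K1 \<epsilon> by linarith
  then have r5: "5 \<le> r" using \<epsilon> by (simp add: r_def pos_le_divide_eq)
  have Kr: "real K = \<epsilon> * r" using \<epsilon> by (simp add: r_def)
  have "80 * real m * ln r = \<epsilon> ^ 3 * (80 * (real m / \<epsilon> ^ 3) * ln r)" using \<epsilon> by simp
  also have "\<dots> \<le> \<epsilon> ^ 3 * B" using B \<epsilon> by (intro mult_left_mono) (auto simp: r_def)
  finally have eB: "80 * real m * ln r \<le> \<epsilon> ^ 3 * B" .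
  \<comment> \<open>Gives \<open>ln r \<ge> 1\<close>, so that the assumption on \<open>B\<close>
    also dominates \<open>m\<close> itself.\<close>
  have "exp (1::real) \<le> r" using exp_le r5 by linarith
  then have "1 \<le> ln r" using r5 by (simp add: ln_ge_iff)
  then have "real m * 1 \<le> real m * ln r" by (intro mult_left_mono) auto
  then have m3: "80 * real m \<le> \<epsilon> ^ 3 * B" using eB by linarith
  then have "0 < \<epsilon> ^ 3 * B" using m by (smt (verit) of_nat_0_less_iff)
  then have B0: "0 < B" using \<epsilon> by (simp add: zero_less_mult_iff)
  have "\<epsilon> ^ 3 * B \<le> \<epsilon>\<^sup>2 * B"
    using \<epsilon> B0 by (intro mult_right_mono power_decreasing) auto
  then show "real m \<le> \<epsilon>\<^sup>2 * B / 4" using m3 by linarith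
  have "real (k * N + 1) \<le> r ^ 3"
  proof -
    have "real k * real N \<le> real K * (4 * real K / \<epsilon> + 1)"
    proof (rule mult_mono)
      have "4 * real k / \<epsilon> \<le> 4 * real K / \<epsilon>" using k \<epsilon> by (intro divide_right_mono) auto
      then show "real N \<le> 4 * real K / \<epsilon> + 1" using N by linarith
    qed (use k in auto)
    also have "\<dots> = 4 * \<epsilon> * r\<^sup>2 + \<epsilon> * r" using \<epsilon> by (simp add: Kr power2_eq_square algebra_simps)
    also have "\<dots> \<le> 4 * r\<^sup>2 / 5 + r / 5"
    proof -
      have "\<epsilon> * r\<^sup>2 \<le> 1 / 5 * r\<^sup>2" "\<epsilon> * r \<le> 1 / 5 * r" using \<epsilon>(2) r5 by (intro mult_right_mono; simp)+
      then show ?thesis by linarith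
    qed
    finally have "real (k * N + 1) \<le> 4 * r\<^sup>2 / 5 + r / 5 + 1" by simp
    also have "\<dots> \<le> 5 * r\<^sup>2"
      using mult_mono [OF r5 r5] r5 by (simp add: power2_eq_square) (use mult_right_mono [OF r5, of r] in linarith)
    also have "\<dots> \<le> r ^ 3" using mult_right_mono [OF r5, of "r\<^sup>2"] by (simp add: power3_eq_cube power2_eq_square)
    finally show ?thesis .
  qed
  then have M: "real ((k * N + 1) ^ m) \<le> (r ^ 3) ^ m" by (simp only: of_nat_power power_mono of_nat_0_le_iff)
  have "exp (- (\<epsilon> ^ 3 * B / 16)) \<le> exp (- (real (5 * m) * ln r))" using eB by simp
  also have "\<dots> = 1 / r ^ (5 * m)" using r5 by (simp only: exp_minus exp_of_nat_mult) (simp add: divide_inverse)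
  finally have X: "exp (- (\<epsilon> ^ 3 * B / 16)) \<le> 1 / r ^ (5 * m)" .
  have "2 * real m * real ((k * N + 1) ^ m) * exp (- (\<epsilon> ^ 3 * B / 16)) \<le> 2 * (\<epsilon> * r) * (r ^ 3) ^ m * (1 / r ^ (5 * m))"
    using M X m(2) r5 \<epsilon> unfolding Kr [symmetric] by (intro mult_mono) auto
  also have "\<dots> = \<epsilon> * (2 * r / r ^ (2 * m))"
  proof -
    have "r ^ (5 * m) = (r ^ 3) ^ m * r ^ (2 * m)" by (simp add: power_mult [symmetric] power_add [symmetric])
    then show ?thesis using r5 by simp
  qed
  also have "\<dots> \<le> \<epsilon> * 1"
  proof (rule mult_left_mono)
    have "2 * r \<le> r ^ 2" using r5 by (simp add: power2_eq_square)
    also have "\<dots> \<le> r ^ (2 * m)" using r5 m by (intro power_increasing) auto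
    finally show "2 * r / r ^ (2 * m) \<le> 1" using r5 by simp
  qed (use \<epsilon> in simp)
  finally show "2 * real m * real ((k * N + 1) ^ m) * exp (- (\<epsilon> ^ 3 * B / 16)) \<le> \<epsilon>" by simp
qed

theorem theorem1:
  "\<exists>C > (0::real). \<forall>m n B \<pi> a \<epsilon> s K \<L> P.
     packing_lp m n B \<pi> a \<longrightarrow>
     0 < \<epsilon> \<longrightarrow> \<epsilon> \<le> 1 \<longrightarrow> real s = \<epsilon> * real n \<longrightarrow>
     m \<le> K \<longrightarrow> finite \<L> \<longrightarrow> card \<L> = K \<longrightarrow> (\<forall>L\<in>\<L>. one_dim_subspace m L) \<longrightarrow> a ` {1..n} \<subseteq> \<Union>\<L> \<longrightarrow>
     B \<ge> C * (real m / \<epsilon> ^ 3) * ln (real K / \<epsilon>) \<longrightarrow>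
     packing_lp.dual_rule m n B \<pi> a s (1 - \<epsilon>) P \<longrightarrow>
       (\<forall>\<sigma>. \<sigma> permutes {1..n} \<longrightarrow>
          packing_lp.feasible m n B a (packing_lp.OTP m n B \<pi> a s P \<sigma>)) \<and>
       measure_pmf.expectation (pmf_of_set {\<sigma>. \<sigma> permutes {1..n}})
         (\<lambda>\<sigma>. packing_lp.val n \<pi> (packing_lp.OTP m n B \<pi> a s P \<sigma>))
       \<ge> (1 - 5 * \<epsilon>) * packing_lp.OPT m n B \<pi> a"
proof (intro exI [of _ 80] conjI allI impI)
  fix m n :: nat and B :: real and \<pi> a \<epsilon> s K \<L> P
  assume lp: "packing_lp m n B \<pi> a" and \<epsilon>: "0 < \<epsilon>" "\<epsilon> \<le> 1" "real s = \<epsilon> * real n"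
    and K: "m \<le> K" "finite \<L>" "card \<L> = K" "\<forall>L\<in>\<L>. one_dim_subspace m L" "a ` {1..n} \<subseteq> \<Union>\<L>"
    and B: "B \<ge> 80 * (real m / \<epsilon> ^ 3) * ln (real K / \<epsilon>)"
    and rule: "packing_lp.dual_rule m n B \<pi> a s (1 - \<epsilon>) P"
  interpret packing_lp m n B \<pi> a by (rule lp)
  show "feasible (OTP s P \<sigma>)" for \<sigma> unfolding OTP_def by (rule feasible_run)
  let ?Perm = "{\<sigma>. \<sigma> permutes {1..n}}"
  have finP: "finite ?Perm" by (rule finite_permutations) simp
  have cardP: "card ?Perm = fact n" using card_permutations [of "{1..n}" n] by simp
  have "(1 - 5 * \<epsilon>) * OPT * fact n \<le> (\<Sum>\<sigma>\<in>?Perm. val (OTP s P \<sigma>))"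
  \<comment> \<open>For larger \<open>\<epsilon>\<close> the claimed value is at most 0.\<close>
  proof (cases "\<epsilon> \<le> 1 / 5")
    case True
    define k where "k = card dirs"
    \<comment> \<open>The error allowance \<open>\<epsilon> / 2 * B\<close> is shared equally among
      the \<open>k\<close> directions, which fixes \<open>\<eta>\<close>; this \<open>N\<close> puts
      the cutoff \<open>N * \<eta>\<close> at \<open>2 * B\<close> or more, safely above
      \<open>B\<close>.\<close>
    define N where "N = nat \<lceil>4 * real k / \<epsilon>\<rceil>"
    define \<eta> where "\<eta> = \<epsilon> * B / (2 * real k)"
    have "dirs \<noteq> {}" using n_pos by (auto simp: dirs_def)
    then have k0: "0 < k" using dirs_facts(1) by (simp add: k_def card_gt_0_iff)
    have kK: "k \<le> K" unfolding k_def using card_dirs_le [of \<L>] K by blast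
    have "0 \<le> 4 * real k / \<epsilon>" using \<epsilon> by simp
    then have N: "4 * real k / \<epsilon> \<le> real N" "real N \<le> 4 * real k / \<epsilon> + 1" unfolding N_def by linarith+
    note arith = union_bound_arith [OF m_pos K(1) kK \<epsilon>(1) True N(2) B]
    have \<eta>: "0 < \<eta>" "real k * \<eta> \<le> \<epsilon> / 2 * B" using k0 \<epsilon> B_pos by (auto simp: \<eta>_def)
    have "2 * B = 4 * real k / \<epsilon> * \<eta>" using k0 \<epsilon> by (simp add: \<eta>_def)
    also have "\<dots> \<le> real N * \<eta>" using N \<eta>(1) by (intro mult_right_mono) auto
    finally have N\<eta>: "B < real N * \<eta>" using B_pos by linarith
    have "real (card {\<sigma>. \<sigma> permutes {1..n} \<and> \<not> good \<epsilon> (P (observed s \<sigma>))})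
      \<le> 2 * real m * real ((k * N + 1) ^ m) * (fact n * exp (- (\<epsilon> ^ 3 * B / 16)))"
      using rule \<eta> N\<eta> arith(2) unfolding k_def dual_rule_def
      by (intro card_bad_orders_le [OF \<epsilon>, where \<eta> = \<eta>]) auto
    also have "\<dots> = (2 * real m * real ((k * N + 1) ^ m) * exp (- (\<epsilon> ^ 3 * B / 16))) * fact n" by simp
    also have "\<dots> \<le> \<epsilon> * fact n" using arith(1) by (intro mult_right_mono) auto
    finally show ?thesis using \<epsilon> True rule by (intro expected_value_ge) auto
  next
    case False
    then have "(1 - 5 * \<epsilon>) * (OPT * fact n) \<le> 0" using OPT_nonneg by (intro mult_nonpos_nonneg) auto
    also have "0 \<le> (\<Sum>\<sigma>\<in>?Perm. val (OTP s P \<sigma>))"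
      using val_le(2) [OF feasible_run] by (intro sum_nonneg) (simp add: OTP_def)
    finally show ?thesis by (simp add: mult.assoc)
  qed
  then have "(1 - 5 * \<epsilon>) * OPT \<le> (\<Sum>\<sigma>\<in>?Perm. val (OTP s P \<sigma>)) / fact n"
    by (simp add: pos_le_divide_eq)
  moreover have "?Perm \<noteq> {}" using permutes_id by blast
  ultimately show "measure_pmf.expectation (pmf_of_set ?Perm) (\<lambda>\<sigma>. val (OTP s P \<sigma>)) \<ge> (1 - 5 * \<epsilon>) * OPT"
    using finP cardP by (simp add: integral_pmf_of_set)
qed simp

end
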